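(* Let $\xi_T$ be $\mathcal F_T$-measurable and bounded, and let $\eta$ be an $\mathbb F$-optional, bounded, nonnegative and right-continuous process. For $n\in\mathbb N$ let $(Y^n,Z^n)\in\mathcal S^2(\mathbb F)\times\mathcal H^2(M)$ be the unique solution to the generalized BSDE $$Y^n_t=\xi_T-\int_{]t,T]}Z^n_s\,dM_s+\int_{]t,T]}n(\eta_s-Y^n_s)^+\,dA_s,\qquad t\in[0,T].$$ Then the sequence $(Y^n)_{n\in\mathbb N}$ is increasing and converges almost surely to the process $V$ which satisfies, for every $t\in[0,T]$, $$V_t=\operatorname{ess\,sup}_{\tau\in\overline{\mathcal T}_{t,T}(\mathbb F)}\mathbb E\big[\xi_T\mathbf 1_{\{\tau=T\}}+\eta_\tau\mathbf 1_{\{\tau<T\}}\,\big|\,\mathcal F_t\big].$$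
   Context: Standing assumptions: $T>0$ is fixed; $(\Omega,\mathcal F,\mathbb P)$ is a probability space with a filtration $\mathbb F=(\mathcal F_t)_{t\in[0,T]}$ satisfying the usual conditions; $M$ is an $\mathbb R^d$-valued square-integrable $\mathbb F$-martingale having the predictable representation property for $\mathbb F$ (local martingales of $\mathbb F$ are, up to their initial value, stochastic integrals $\int Z\,dM$ of $\mathbb F$-predictable processes); $A$ is an $\mathbb F$-adapted, nondecreasing, continuous process with $A_0=0$ and $\mathbb E[A_T^2]<\infty$. The paper's assumption on a generator $g$, namely $\mathbb E\big[\int_{]0,T]}|g(t,0)|^2\,dA_t\big]<\infty$ and Lipschitz continuity in $y$ with a constant $L$ uniform in $(\omega,t)$, is in force (for the generators $n(\eta_t-y)^+$). Spaces: $\mathcal H^2(M)$ is the space of $\mathbb F$-predictable $Z$ with $\|Z\|^2_{\mathcal H^2(M)}=\mathbb E\big[\int_{]0,T]}|Z_s|^2\,d[M]_s\big]<\infty$ (the integral denotes the quadratic variation of $\int Z\,dM$ at $T$). With $\mathcal T(\mathbb F)$ the class of $\mathbb F$-stopping times with values in $[0,T]$, $\mathcal S^2(\mathbb F)$ is the space of $\mathbb F$-optional $X$ with $\|X\|^2_{\mathcal S^2(\mathbb F)}=\mathbb E\big[\operatorname{ess\,sup}_{\tau\in\mathcal T(\mathbb F)}|X_\tau|^2\big]<\infty$. In a solution of a generalized BSDE, $Y$ is $\mathbb F$-adapted and càdlàg, $Z$ is $\mathbb F$-predictable, the equation holds for all $t\in[0,T]$, $\int_{]0,t]}Z_s\,dM_s$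 is a martingale and the $dA$-integral is an $\mathbb F$-adapted continuous process of finite variation; uniqueness is in the (pseudo-)norms of $\mathcal S^2(\mathbb F)$ and $\mathcal H^2(M)$. Right support: $S^r=S^r(A):=\{t\in\mathbb R_+:\ \forall\varepsilon>0\ \ A_{t+\varepsilon}-A_t>0\}$ (a random set) and $\overline S:=S^r\cup\{T\}$. $\overline{\mathcal T}(\mathbb F)$ is the class of $\mathbb F$-stopping times $\tau$ with values in $[0,T]$ such that $\mathbb P(\tau\in\overline S)=1$, and $\overline{\mathcal T}_{t,T}(\mathbb F)$ is the set of $\tau\in\overline{\mathcal T}(\mathbb F)$ with $\mathbb P(\tau\in\overline S\cap[t,T])=1$. *)

theory Defs
  imports "HOL-Probability.Probability"
begin

text \<open>
  The time interval is \<open>[0, T]\<close>. Processes are functions \<open>real \<Rightarrow> 'a \<Rightarrow> _\<close> (time first) and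
  filtrations are indexed by \<open>real\<close>, as required by \<^const>\<open>stopping_time\<close> and
  \<^locale>\<open>filtration\<close>; only times in \<open>[0, T]\<close> matter. A filtration on \<open>[0, T]\<close> is extended
  by constants to the whole line, and for a \<open>[0, T]\<close>-valued map the condition defining a
  stopping time is void at times outside \<open>[0, T]\<close>. Properties of paths are required of
  almost all paths, except for the generators of the optional \<open>\<sigma>\<close>-algebra.
\<close>

section \<open>Filtrations, stopping times, processes\<close>

definition usual_filtration :: "'a measure \<Rightarrow> (real \<Rightarrow> 'a measure) \<Rightarrow> real \<Rightarrow> bool" where
  "usual_filtration P F T \<longleftrightarrow>
     filtration (space P) F \<and>
     (\<forall>t\<in>{0..T}. subalgebra P (F t)) \<and>
     (\<forall>N\<in>null_sets P. \<forall>N'\<subseteq>N. N' \<in> sets (F 0)) \<and>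
     (\<forall>t\<in>{0..<T}. sets (F t) = (\<Inter>s\<in>{t<..T}. sets (F s)))"

definition stopping_times :: "'a measure \<Rightarrow> (real \<Rightarrow> 'a measure) \<Rightarrow> real \<Rightarrow> ('a \<Rightarrow> real) set" where
  "stopping_times P F T =
     {\<tau>. stopping_time F \<tau> \<and> (\<forall>\<omega>\<in>space P. \<tau> \<omega> \<in> {0..T})}"

definition adapted :: "(real \<Rightarrow> 'a measure) \<Rightarrow> real \<Rightarrow> (real \<Rightarrow> 'a \<Rightarrow> 'b::topological_space) \<Rightarrow> bool" where
  "adapted F T X \<longleftrightarrow> (\<forall>t\<in>{0..T}. X t \<in> borel_measurable (F t))"

definition right_cont_path :: "real \<Rightarrow> (real \<Rightarrow> 'b::topological_space) \<Rightarrow> bool" where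
  "right_cont_path T f \<longleftrightarrow> (\<forall>t\<in>{0..<T}. (f \<longlongrightarrow> f t) (at_right t))"

definition cadlag_path :: "real \<Rightarrow> (real \<Rightarrow> 'b::topological_space) \<Rightarrow> bool" where
  "cadlag_path T f \<longleftrightarrow> right_cont_path T f \<and> (\<forall>t\<in>{0<..T}. \<exists>l. (f \<longlongrightarrow> l) (at_left t))"

definition predictable_sigma :: "'a measure \<Rightarrow> (real \<Rightarrow> 'a measure) \<Rightarrow> real \<Rightarrow> (real \<times> 'a) measure" where
  "predictable_sigma P F T = sigma ({0..T} \<times> space P)
     ({{0} \<times> B |B. B \<in> sets (F 0)} \<union>
      {{s<..t} \<times> B |s t B. 0 \<le> s \<and> s \<le> t \<and> t \<le> T \<and> B \<in> sets (F s)})"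

definition predictable ::
  "'a measure \<Rightarrow> (real \<Rightarrow> 'a measure) \<Rightarrow> real \<Rightarrow> (real \<Rightarrow> 'a \<Rightarrow> 'b::topological_space) \<Rightarrow> bool" where
  "predictable P F T X \<longleftrightarrow> (\<lambda>(t, \<omega>). X t \<omega>) \<in> borel_measurable (predictable_sigma P F T)"

definition optional_sigma :: "'a measure \<Rightarrow> (real \<Rightarrow> 'a measure) \<Rightarrow> real \<Rightarrow> (real \<times> 'a) measure" where
  "optional_sigma P F T = sigma ({0..T} \<times> space P)
     {{(t, \<omega>) \<in> {0..T} \<times> space P. X t \<omega> \<in> B} |(X :: real \<Rightarrow> 'a \<Rightarrow> real) B.
        adapted F T X \<and> (\<forall>\<omega>\<in>space P. cadlag_path T (\<lambda>t. X t \<omega>)) \<and> B \<in> sets borel}"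

definition optional ::
  "'a measure \<Rightarrow> (real \<Rightarrow> 'a measure) \<Rightarrow> real \<Rightarrow> (real \<Rightarrow> 'a \<Rightarrow> 'b::topological_space) \<Rightarrow> bool" where
  "optional P F T X \<longleftrightarrow> (\<lambda>(t, \<omega>). X t \<omega>) \<in> borel_measurable (optional_sigma P F T)"

text \<open>
  Essential supremum of a family of random variables. (The library constant
  \<^const>\<open>esssup\<close> is the essential supremum of a single function.)
\<close>

definition is_ess_sup ::
  "'a measure \<Rightarrow> ('a \<Rightarrow> 'b::linorder_topology) set \<Rightarrow> ('a \<Rightarrow> 'b) \<Rightarrow> bool" where
  "is_ess_sup P \<Phi> X \<longleftrightarrow>
     X \<in> borel_measurable P \<and>
     (\<forall>\<phi>\<in>\<Phi>. AE \<omega> in P. \<phi> \<omega> \<le> X \<omega>) \<and>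
     (\<forall>X'\<in>borel_measurable P. (\<forall>\<phi>\<in>\<Phi>. AE \<omega> in P. \<phi> \<omega> \<le> X' \<omega>) \<longrightarrow> (AE \<omega> in P. X \<omega> \<le> X' \<omega>))"

definition S2_space :: "'a measure \<Rightarrow> (real \<Rightarrow> 'a measure) \<Rightarrow> real \<Rightarrow> (real \<Rightarrow> 'a \<Rightarrow> real) set" where
  "S2_space P F T = {X. optional P F T X \<and>
     (\<exists>G. is_ess_sup P {\<lambda>\<omega>. ennreal (\<bar>X (\<tau> \<omega>) \<omega>\<bar>\<^sup>2) |\<tau>. \<tau> \<in> stopping_times P F T} G \<and>
          (\<integral>\<^sup>+\<omega>. G \<omega> \<partial>P) < \<infinity>)}"

section \<open>Martingales and local martingales\<close>

definition martingale :: "'a measure \<Rightarrow> (real \<Rightarrow> 'a measure) \<Rightarrow> real \<Rightarrow> (real \<Rightarrow> 'a \<Rightarrow> real) \<Rightarrow> bool" where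
  "martingale P F T X \<longleftrightarrow>
     adapted F T X \<and>
     (AE \<omega> in P. cadlag_path T (\<lambda>t. X t \<omega>)) \<and>
     (\<forall>t\<in>{0..T}. integrable P (X t)) \<and>
     (\<forall>s\<in>{0..T}. \<forall>t\<in>{s..T}. AE \<omega> in P. real_cond_exp P (F s) (X t) \<omega> = X s \<omega>)"

definition square_integrable_martingale ::
  "'a measure \<Rightarrow> (real \<Rightarrow> 'a measure) \<Rightarrow> real \<Rightarrow> (real \<Rightarrow> 'a \<Rightarrow> real ^ 'd) \<Rightarrow> bool" where
  "square_integrable_martingale P F T M \<longleftrightarrow>
     (\<forall>i. martingale P F T (\<lambda>t \<omega>. M t \<omega> $ i)) \<and>
     (\<forall>t\<in>{0..T}. integrable P (\<lambda>\<omega>. (norm (M t \<omega>))\<^sup>2))"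

text \<open>
  On a compact time interval localising sequences may be taken \<open>[0, T]\<close>-valued and
  eventually equal to \<open>T\<close>.
\<close>

definition local_martingale ::
  "'a measure \<Rightarrow> (real \<Rightarrow> 'a measure) \<Rightarrow> real \<Rightarrow> (real \<Rightarrow> 'a \<Rightarrow> real) \<Rightarrow> bool" where
  "local_martingale P F T X \<longleftrightarrow>
     adapted F T X \<and>
     (AE \<omega> in P. cadlag_path T (\<lambda>t. X t \<omega>)) \<and>
     (\<exists>\<tau>. (\<forall>k::nat. \<tau> k \<in> stopping_times P F T) \<and>
          (AE \<omega> in P. incseq (\<lambda>k. \<tau> k \<omega>) \<and> (\<exists>k. \<tau> k \<omega> = T)) \<and>
          (\<forall>k. martingale P F T (\<lambda>t \<omega>. X (min t (\<tau> k \<omega>)) \<omega> - X 0 \<omega>)))"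

section \<open>Stochastic integrals\<close>

definition partition_of :: "real \<Rightarrow> (nat \<Rightarrow> real) \<Rightarrow> nat \<Rightarrow> bool" where
  "partition_of t p m \<longleftrightarrow> p 0 = 0 \<and> p m = t \<and> (\<forall>i<m. p i \<le> p (Suc i))"

definition finite_variation_path :: "real \<Rightarrow> (real \<Rightarrow> real) \<Rightarrow> bool" where
  "finite_variation_path T f \<longleftrightarrow>
     (\<exists>C. \<forall>p m. partition_of T p m \<longrightarrow> (\<Sum>i<m. \<bar>f (p (Suc i)) - f (p i)\<bar>) \<le> C)"

text \<open>
  \<open>Q\<close> is a version of the quadratic covariation \<open>[X, Y]\<close>, normalised by \<open>[X, Y]\<^sub>0 = 0\<close>: the
  limit in probability of the sums of products of increments, along every sequence of
  partitions with mesh tending to 0.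
\<close>

definition is_quad_covariation ::
  "'a measure \<Rightarrow> (real \<Rightarrow> 'a measure) \<Rightarrow> real \<Rightarrow> (real \<Rightarrow> 'a \<Rightarrow> real) \<Rightarrow> (real \<Rightarrow> 'a \<Rightarrow> real) \<Rightarrow>
     (real \<Rightarrow> 'a \<Rightarrow> real) \<Rightarrow> bool" where
  "is_quad_covariation P F T X Y Q \<longleftrightarrow>
     adapted F T Q \<and>
     (AE \<omega> in P. cadlag_path T (\<lambda>t. Q t \<omega>)) \<and>
     (\<forall>t\<in>{0..T}. \<forall>p m.
        (\<forall>k. partition_of t (p k) (m k)) \<longrightarrow>
        (\<forall>\<delta>>0. \<forall>\<^sub>F k in sequentially. \<forall>i<m k. p k (Suc i) - p k i < \<delta>) \<longrightarrow>
        (\<forall>\<epsilon>>0. (\<lambda>k. measure P {\<omega> \<in> space P.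
             \<bar>(\<Sum>i<m k. (X (p k (Suc i)) \<omega> - X (p k i) \<omega>) * (Y (p k (Suc i)) \<omega> - Y (p k i) \<omega>))
                - Q t \<omega>\<bar> > \<epsilon>}) \<longlonglongrightarrow> 0))"

text \<open>
  \<open>r t = \<integral>\<^bsub>]0,t]\<^esub> (\<Sum>i. h\<^sub>i da\<^sub>i)\<close> for \<open>t \<in> [0, T]\<close>, for paths \<open>a\<^sub>i\<close> of finite variation with densities
  \<open>k\<^sub>i\<close> relative to a common finite measure \<open>\<mu>\<close>; the value does not depend on the choice of
  \<open>\<mu>\<close> and \<open>k\<close>. Only the sum of the \<open>h\<^sub>i k\<^sub>i\<close> has to be integrable, not each summand.
\<close>

definition has_vector_stieltjes_integral ::
  "real \<Rightarrow> (real \<Rightarrow> real ^ 'd) \<Rightarrow> ('d \<Rightarrow> real \<Rightarrow> real) \<Rightarrow> (real \<Rightarrow> real) \<Rightarrow> bool" where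
  "has_vector_stieltjes_integral T h a r \<longleftrightarrow>
     (\<exists>\<mu> k. finite_measure \<mu> \<and> sets \<mu> = sets borel \<and>
        (\<forall>i. set_integrable \<mu> {0<..T} (k i)) \<and>
        (\<forall>i. \<forall>t\<in>{0..T}. a i t - a i 0 = (LINT s:{0<..t}|\<mu>. k i s)) \<and>
        set_integrable \<mu> {0<..T} (\<lambda>s. \<Sum>i\<in>UNIV. h s $ i * k i s) \<and>
        (\<forall>t\<in>{0..T}. r t = (LINT s:{0<..t}|\<mu>. (\<Sum>i\<in>UNIV. h s $ i * k i s))))"

text \<open>
  \<open>N = \<integral> Z dM\<close> in the sense of local martingales: \<open>N\<close> is the local martingale, null at 0 and
  unique up to indistinguishability, such that \<open>[N, L] = \<integral> Z d[M, L]\<close> for every local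
  martingale \<open>L\<close>.
\<close>

definition is_stoch_integral ::
  "'a measure \<Rightarrow> (real \<Rightarrow> 'a measure) \<Rightarrow> real \<Rightarrow> (real \<Rightarrow> 'a \<Rightarrow> real ^ 'd) \<Rightarrow>
     (real \<Rightarrow> 'a \<Rightarrow> real ^ 'd) \<Rightarrow> (real \<Rightarrow> 'a \<Rightarrow> real) \<Rightarrow> bool" where
  "is_stoch_integral P F T M Z N \<longleftrightarrow>
     predictable P F T Z \<and> local_martingale P F T N \<and> (AE \<omega> in P. N 0 \<omega> = 0) \<and>
     (\<forall>L. local_martingale P F T L \<longrightarrow>
        (\<exists>Q q. is_quad_covariation P F T N L Q \<and>
               (\<forall>i. is_quad_covariation P F T (\<lambda>t \<omega>. M t \<omega> $ i) L (q i)) \<and>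
               (AE \<omega> in P. has_vector_stieltjes_integral T
                  (\<lambda>t. Z t \<omega>) (\<lambda>i t. q i t \<omega>) (\<lambda>t. Q t \<omega>))))"

definition predictable_representation ::
  "'a measure \<Rightarrow> (real \<Rightarrow> 'a measure) \<Rightarrow> real \<Rightarrow> (real \<Rightarrow> 'a \<Rightarrow> real ^ 'd) \<Rightarrow> bool" where
  "predictable_representation P F T M \<longleftrightarrow>
     (\<forall>N. local_martingale P F T N \<longrightarrow>
        (\<exists>Z. predictable P F T Z \<and> is_stoch_integral P F T M Z (\<lambda>t \<omega>. N t \<omega> - N 0 \<omega>)))"

definition H2_space ::
  "'a measure \<Rightarrow> (real \<Rightarrow> 'a measure) \<Rightarrow> real \<Rightarrow> (real \<Rightarrow> 'a \<Rightarrow> real ^ 'd) \<Rightarrow>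
     (real \<Rightarrow> 'a \<Rightarrow> real ^ 'd) set" where
  "H2_space P F T M = {Z. predictable P F T Z \<and>
     (\<exists>N Q. is_stoch_integral P F T M Z N \<and> is_quad_covariation P F T N N Q \<and>
            (\<integral>\<^sup>+\<omega>. ennreal (Q T \<omega>) \<partial>P) < \<infinity>)}"

section \<open>Generalized BSDEs\<close>

text \<open>The measure \<open>dA\<^sub>t(\<omega>)\<close> on \<open>]0, T]\<close>: the path is made constant outside \<open>[0, T]\<close>.\<close>

definition path_measure :: "real \<Rightarrow> (real \<Rightarrow> 'a \<Rightarrow> real) \<Rightarrow> 'a \<Rightarrow> real measure" where
  "path_measure T A \<omega> = interval_measure (\<lambda>s. A (max 0 (min T s)) \<omega>)"

definition clock_process ::
  "'a measure \<Rightarrow> (real \<Rightarrow> 'a measure) \<Rightarrow> real \<Rightarrow> (real \<Rightarrow> 'a \<Rightarrow> real) \<Rightarrow> bool" where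
  "clock_process P F T A \<longleftrightarrow>
     adapted F T A \<and>
     (AE \<omega> in P. A 0 \<omega> = 0 \<and> mono_on {0..T} (\<lambda>t. A t \<omega>) \<and> continuous_on {0..T} (\<lambda>t. A t \<omega>)) \<and>
     integrable P (\<lambda>\<omega>. (A T \<omega>)\<^sup>2)"

definition generator_assumption ::
  "'a measure \<Rightarrow> real \<Rightarrow> (real \<Rightarrow> 'a \<Rightarrow> real) \<Rightarrow> (real \<Rightarrow> 'a \<Rightarrow> real \<Rightarrow> real) \<Rightarrow> bool" where
  "generator_assumption P T A g \<longleftrightarrow>
     (\<integral>\<^sup>+\<omega>. (\<integral>\<^sup>+t\<in>{0<..T}. ennreal (\<bar>g t \<omega> 0\<bar>\<^sup>2) \<partial>path_measure T A \<omega>) \<partial>P) < \<infinity> \<and>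
     (\<exists>L. \<forall>t\<in>{0..T}. \<forall>\<omega>\<in>space P. \<forall>y y'. \<bar>g t \<omega> y - g t \<omega> y'\<bar> \<le> L * \<bar>y - y'\<bar>)"

text \<open>
  \<open>(Y, Z)\<close> solves
  \<open>Y\<^sub>t = \<xi> - \<integral>\<^bsub>]t,T]\<^esub> Z\<^sub>s dM\<^sub>s + \<integral>\<^bsub>]t,T]\<^esub> g(s, Y\<^sub>s) dA\<^sub>s\<close> on \<open>[0, T]\<close>; in the definition \<open>N\<close> is \<open>\<integral> Z dM\<close>.
\<close>

definition gbsde_solution ::
  "'a measure \<Rightarrow> (real \<Rightarrow> 'a measure) \<Rightarrow> real \<Rightarrow> (real \<Rightarrow> 'a \<Rightarrow> real ^ 'd) \<Rightarrow> (real \<Rightarrow> 'a \<Rightarrow> real) \<Rightarrow>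
     ('a \<Rightarrow> real) \<Rightarrow> (real \<Rightarrow> 'a \<Rightarrow> real \<Rightarrow> real) \<Rightarrow>
     (real \<Rightarrow> 'a \<Rightarrow> real) \<Rightarrow> (real \<Rightarrow> 'a \<Rightarrow> real ^ 'd) \<Rightarrow> bool" where
  "gbsde_solution P F T M A \<xi> g Y Z \<longleftrightarrow>
     adapted F T Y \<and> (AE \<omega> in P. cadlag_path T (\<lambda>t. Y t \<omega>)) \<and> predictable P F T Z \<and>
     (AE \<omega> in P. set_integrable (path_measure T A \<omega>) {0<..T} (\<lambda>s. g s \<omega> (Y s \<omega>))) \<and>
     adapted F T (\<lambda>t \<omega>. LINT s:{0<..t}|path_measure T A \<omega>. g s \<omega> (Y s \<omega>)) \<and>
     (AE \<omega> in P.
        continuous_on {0..T} (\<lambda>t. LINT s:{0<..t}|path_measure T A \<omega>. g s \<omega> (Y s \<omega>)) \<and>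
        finite_variation_path T (\<lambda>t. LINT s:{0<..t}|path_measure T A \<omega>. g s \<omega> (Y s \<omega>))) \<and>
     (\<exists>N. is_stoch_integral P F T M Z N \<and> martingale P F T N \<and>
        (AE \<omega> in P. \<forall>t\<in>{0..T}.
           Y t \<omega> = \<xi> \<omega> - (N T \<omega> - N t \<omega>)
             + (LINT s:{t<..T}|path_measure T A \<omega>. g s \<omega> (Y s \<omega>))))"

section \<open>Right support and the restricted stopping times\<close>

text \<open>
  The set \<open>S\<^sup>r\<close> for a single path \<open>a\<close> on \<open>[0, T]\<close>, which is continued by \<open>a T\<close> after \<open>T\<close>; hence
  no \<open>t \<ge> T\<close> belongs to the set.
\<close>

definition right_support :: "real \<Rightarrow> (real \<Rightarrow> real) \<Rightarrow> real set" where
  "right_support T a = {t. 0 \<le> t \<and> (\<forall>\<epsilon>>0. a (min (t + \<epsilon>) T) - a (min t T) > 0)}"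

definition support_bar :: "real \<Rightarrow> (real \<Rightarrow> 'a \<Rightarrow> real) \<Rightarrow> 'a \<Rightarrow> real set" where
  "support_bar T A \<omega> = right_support T (\<lambda>t. A t \<omega>) \<union> {T}"

definition support_stopping_times ::
  "'a measure \<Rightarrow> (real \<Rightarrow> 'a measure) \<Rightarrow> real \<Rightarrow> (real \<Rightarrow> 'a \<Rightarrow> real) \<Rightarrow> ('a \<Rightarrow> real) set" where
  "support_stopping_times P F T A =
     {\<tau> \<in> stopping_times P F T. AE \<omega> in P. \<tau> \<omega> \<in> support_bar T A \<omega>}"

definition support_stopping_times_from ::
  "'a measure \<Rightarrow> (real \<Rightarrow> 'a measure) \<Rightarrow> real \<Rightarrow> (real \<Rightarrow> 'a \<Rightarrow> real) \<Rightarrow> real \<Rightarrow> ('a \<Rightarrow> real) set" where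
  "support_stopping_times_from P F T A t =
     {\<tau> \<in> support_stopping_times P F T A. AE \<omega> in P. \<tau> \<omega> \<in> support_bar T A \<omega> \<inter> {t..T}}"

end

theory Submission
  imports Defs
begin

text \<open>
  Write \<open>I\<^sup>n\<^sub>t = \<integral>\<^bsub>]0,t]\<^esub> n (\<eta>\<^sub>s - Y\<^sup>n\<^sub>s)\<^sup>+ dA\<^sub>s\<close> for the accumulated penalty. The equation says that
  \<open>Y\<^sup>n + I\<^sup>n\<close> is a martingale with terminal value \<open>\<xi> + I\<^sup>n\<^sub>T\<close>. The whole proof stops this one martingale
  at suitable passage times; the membership of \<open>Y\<^sup>n\<close> in \<open>\<S>\<^sup>2\<close> dominates the stopped values, so that
  optional stopping follows from dominated convergence along a grid.

  Monotonicity in \<open>n\<close>. The generator \<open>n (\<eta> - y)\<^sup>+\<close> decreases in \<open>y\<close> and increases in \<open>n\<close>. Let \<open>n \<le> m\<close>. Until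
  the first time after \<open>t\<close> at which \<open>Y\<^sup>n - Y\<^sup>m < \<delta>\<close>, the solution \<open>Y\<^sup>n\<close> lies above \<open>Y\<^sup>m\<close>, so its penalty grows no
  faster; at that time the difference is at most \<open>\<delta>\<close>. Conditioning on \<open>\<F>\<^sub>t\<close> gives \<open>Y\<^sup>n\<^sub>t - Y\<^sup>m\<^sub>t \<le> \<delta>\<close>.

  Upper bound. Let \<open>\<sigma>\<close> be the first time after \<open>t\<close> at which \<open>I\<^sup>n\<close> starts to increase. Then \<open>I\<^sup>n\<close> is
  constant on \<open>[t, \<sigma>]\<close>, hence \<open>Y\<^sup>n\<^sub>t = E[Y\<^sup>n\<^sub>\<sigma> | \<F>\<^sub>t]\<close>. If \<open>\<sigma> < T\<close>, then \<open>A\<close> increases immediately after \<open>\<sigma>\<close>, that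
  is \<open>\<sigma> \<in> S\<^sup>r\<close>, and there are times decreasing to \<open>\<sigma>\<close> at which \<open>Y\<^sup>n < \<eta>\<close>, so \<open>Y\<^sup>n\<^sub>\<sigma> \<le> \<eta>\<^sub>\<sigma>\<close> by right-continuity.
  Thus \<open>Y\<^sup>n\<^sub>t\<close> is at most the conditional expected payoff of \<open>\<sigma>\<close>. In particular \<open>Y\<^sup>n\<close> is bounded by the
  common bound \<open>K\<close> of \<open>\<xi>\<close> and \<open>\<eta>\<close>, and the expected total penalty is at most \<open>2 K\<close>, uniformly in \<open>n\<close>.

  Lower bound. Let \<open>\<tau>\<close> be an admissible stopping time and let \<open>\<rho>\<^sub>n\<close> be the first time after \<open>\<tau>\<close> at which
  \<open>Y\<^sup>n > \<eta> - \<delta>\<close>. Between \<open>\<tau>\<close> and \<open>\<rho>\<^sub>n\<close> the penalty grows at rate at least \<open>n \<delta>\<close> with respect to \<open>dA\<close>, so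
  \<open>n \<delta> E[A\<^bsub>\<rho>\<^sub>n\<^esub> - A\<^sub>\<tau>] \<le> 2 K\<close>. The times \<open>\<rho>\<^sub>n\<close> decrease in \<open>n\<close>, hence \<open>A\<^bsub>\<rho>\<^sub>n\<^esub> \<rightarrow> A\<^sub>\<tau>\<close> almost surely. As \<open>A\<close> increases
  immediately after a point of the right support, this forces \<open>\<rho>\<^sub>n \<rightarrow> \<tau>\<close>, and the payoffs of \<open>\<rho>\<^sub>n\<close> converge
  to the payoff of \<open>\<tau>\<close>. Since \<open>Y\<^sup>n\<^sub>t \<ge> E[Y\<^sup>n at \<rho>\<^sub>n | \<F>\<^sub>t]\<close>, which is at least the conditional expected payoff
  of \<open>\<rho>\<^sub>n\<close> minus \<open>\<delta>\<close>, letting \<open>n \<rightarrow> \<infinity>\<close> and then \<open>\<delta> \<rightarrow> 0\<close> bounds the limit from below.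

  The carrying lemmas are \<open>balance\<close>, \<open>penalized_solution_mono\<close>, \<open>le_cond_exp_payoff\<close> and
  \<open>contact_payoff_converges\<close>.
\<close>

section \<open>Right-continuous paths and passage times\<close>

lemma right_cont_path_sequence:
  fixes f :: "real \<Rightarrow> 'b::topological_space"
  assumes f: "right_cont_path T f" and s: "0 \<le> s"
    and u: "\<And>k. s \<le> u k" "\<And>k. u k \<le> T" "u \<longlonglongrightarrow> s"
  shows "(\<lambda>k. f (u k)) \<longlonglongrightarrow> f s"
proof (cases "s < T")
  case True
  then have lim: "(f \<longlongrightarrow> f s) (at_right s)"
    using f s by (auto simp: right_cont_path_def)
  show ?thesis
  proof (rule topological_tendstoI)
    fix S assume S: "open S" "f s \<in> S"
    then have "eventually (\<lambda>x. f x \<in> S) (at_right s)"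
      using lim by (auto simp: tendsto_def)
    then obtain b where b: "b > s" "\<And>y. s < y \<Longrightarrow> y < b \<Longrightarrow> f y \<in> S"
      by (auto simp: eventually_at_right_field)
    have "eventually (\<lambda>k. u k < b) sequentially"
      using u(3) b(1) by (rule order_tendstoD)
    then show "eventually (\<lambda>k. f (u k) \<in> S) sequentially"
    proof eventually_elim
      case (elim k)
      then show ?case using b(2)[of "u k"] u(1)[of k] S(2) by (cases "u k = s") auto
    qed
  qed
next
  case False
  then have "u k = s" for k using u(1)[of k] u(2)[of k] by auto
  then show ?thesis by simp
qed

lemma continuous_on_imp_right_cont_path:
  assumes "continuous_on {0..T} f"
  shows "right_cont_path T f"
  unfolding right_cont_path_def
proof
  fix t assume t: "t \<in> {0..<T}"
  then have "continuous_on {t..T} f" by (intro continuous_on_subset[OF assms]) auto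
  then have "(f \<longlongrightarrow> f t) (at t within {t..T})" using t by (auto simp: continuous_on_def)
  then show "(f \<longlongrightarrow> f t) (at_right t)" using t by (simp add: at_within_Icc_at_right)
qed

text \<open>
  The infimum runs over rational times only. Passage of a process before a time \<open>s\<close> is then exactly
  a countable union of events observed before \<open>s\<close>, with no exceptional null set, and on
  right-continuous paths nothing is lost.
\<close>

definition passage_time :: "real \<Rightarrow> real \<Rightarrow> (real \<Rightarrow> real) \<Rightarrow> real \<Rightarrow> real" where
  "passage_time T a f c = Inf (insert T {q \<in> \<rat>. a \<le> q \<and> q \<le> T \<and> c < f q})"

lemma passage_time_le: "passage_time T a f c \<le> T"
  and passage_time_ge: "a \<le> T \<Longrightarrow> a \<le> passage_time T a f c"
proof -
  have "bdd_below (insert T {q \<in> \<rat>. a \<le> q \<and> q \<le> T \<and> c < f q})"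
    by (rule bdd_belowI[of _ "min T a"]) auto
  then show "passage_time T a f c \<le> T"
    unfolding passage_time_def by (intro cInf_lower) auto
  show "a \<le> T \<Longrightarrow> a \<le> passage_time T a f c"
    unfolding passage_time_def by (intro cInf_greatest) auto
qed

lemma passage_time_less_iff:
  assumes "s \<le> T"
  shows "passage_time T a f c < s \<longleftrightarrow> (\<exists>q\<in>\<rat>. a \<le> q \<and> q < s \<and> c < f q)"
proof -
  have "bdd_below (insert T {q \<in> \<rat>. a \<le> q \<and> q \<le> T \<and> c < f q})"
    by (rule bdd_belowI[of _ "min T a"]) auto
  then have "passage_time T a f c < s \<longleftrightarrow>
      (\<exists>q\<in>insert T {q \<in> \<rat>. a \<le> q \<and> q \<le> T \<and> c < f q}. q < s)"
    unfolding passage_time_def by (intro cInf_less_iff) auto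
  then show ?thesis using assms by force
qed

lemma passage_time_least:
  "q \<in> \<rat> \<Longrightarrow> a \<le> q \<Longrightarrow> q \<le> T \<Longrightarrow> c < f q \<Longrightarrow> passage_time T a f c \<le> q"
  unfolding passage_time_def by (rule cInf_lower) (auto intro: bdd_belowI[of _ a])

lemma passage_time_antimono:
  assumes "a \<le> T" and "\<And>q. a \<le> q \<Longrightarrow> q \<le> T \<Longrightarrow> f q \<le> g q"
  shows "passage_time T a g c \<le> passage_time T a f c"
  unfolding passage_time_def
  using assms by (intro cInf_superset_mono) (auto intro: bdd_belowI[of _ a] less_le_trans)

text \<open>
  A violation \<open>c < f s\<close> would persist on a right neighbourhood of \<open>s\<close> and hence at a rational time before
  the passage time.
\<close>

lemma passage_time_before:
  assumes f: "right_cont_path T f" and s: "0 \<le> s" "a \<le> s" "s < passage_time T a f c"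
  shows "f s \<le> c"
proof -
  have sT: "s < T" using s(3) passage_time_le[of T a f c] by simp
  have lim: "(f \<longlongrightarrow> f s) (at_right s)"
    using f s(1) sT by (auto simp: right_cont_path_def)
  show ?thesis
  proof (rule ccontr)
    assume "\<not> f s \<le> c"
    then have "eventually (\<lambda>x. c < f x) (at_right s)"
      using lim by (intro order_tendstoD) auto
    then obtain b where b: "b > s" "\<And>y. s < y \<Longrightarrow> y < b \<Longrightarrow> c < f y"
      by (auto simp: eventually_at_right_field)
    obtain q where q: "q \<in> \<rat>" "s < q" "q < min b (passage_time T a f c)"
      using Rats_dense_in_real[of s "min b (passage_time T a f c)"] b(1) s(3) by auto
    obtain q' where q': "q < q'" "q' < passage_time T a f c"
      using dense[of q "passage_time T a f c"] q by auto
    have "passage_time T a f c < q'"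
      using passage_time_less_iff[of q' T a f c] q q' b(2)[of q] s(2)
        passage_time_le[of T a f c] by (force intro: bexI[of _ q])
    then show False using q' by simp
  qed
qed

text \<open>
  If the passage time is not itself a rational time with \<open>c < f q\<close>, such times accumulate at it from the
  right; the inequality becomes weak in the limit.
\<close>

lemma passage_time_at:
  assumes f: "right_cont_path T f" and a: "0 \<le> a" "a \<le> T" and r: "passage_time T a f c < T"
  shows "c \<le> f (passage_time T a f c)"
proof -
  let ?r = "passage_time T a f c"
  have r0: "0 \<le> ?r" using passage_time_ge[OF a(2), of f c] a(1) by simp
  have lim: "(f \<longlongrightarrow> f ?r) (at_right ?r)"
    using f r r0 by (auto simp: right_cont_path_def)
  show ?thesis
  proof (rule ccontr)
    assume less: "\<not> c \<le> f ?r"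
    then have "eventually (\<lambda>x. f x < c) (at_right ?r)"
      using lim by (intro order_tendstoD) auto
    then obtain b where b: "b > ?r" "\<And>y. ?r < y \<Longrightarrow> y < b \<Longrightarrow> f y < c"
      by (auto simp: eventually_at_right_field)
    then have "?r < min b T" using r by auto
    then obtain q where q: "q \<in> \<rat>" "a \<le> q" "q < min b T" "c < f q"
      using passage_time_less_iff[of "min b T" T a f c] by auto
    have "?r \<le> q" using q by (intro passage_time_least) auto
    then show False using b(2)[of q] q less by (cases "q = ?r") auto
  qed
qed

section \<open>Integrals along one path of the clock\<close>

context
  fixes T :: real and A :: "real \<Rightarrow> 'a \<Rightarrow> real" and \<omega> :: 'a
  assumes T: "0 < T" and mono: "mono_on {0..T} (\<lambda>t. A t \<omega>)"
    and cont: "continuous_on {0..T} (\<lambda>t. A t \<omega>)"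
begin

lemma sets_path_measure [measurable_cong]: "sets (path_measure T A \<omega>) = sets borel"
  by (simp add: path_measure_def)

lemma extended_path_mono: "x \<le> y \<Longrightarrow> A (max 0 (min T x)) \<omega> \<le> A (max 0 (min T y)) \<omega>"
  using mono T by (auto simp: mono_on_def)

lemma extended_path_continuous: "continuous_on UNIV (\<lambda>s. A (max 0 (min T s)) \<omega>)"
  using T by (intro continuous_on_compose2[OF cont] continuous_intros) auto

lemma emeasure_path_measure_Ioc:
  assumes "0 \<le> s" "s \<le> t" "t \<le> T"
  shows "emeasure (path_measure T A \<omega>) {s<..t} = ennreal (A t \<omega> - A s \<omega>)"
proof -
  have "emeasure (path_measure T A \<omega>) {s<..t} =
      ennreal (A (max 0 (min T t)) \<omega> - A (max 0 (min T s)) \<omega>)"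
    unfolding path_measure_def
    using assms(2) extended_path_mono extended_path_continuous
    by (intro emeasure_interval_measure_Ioc)
       (auto simp: continuous_on_eq_continuous_at intro: continuous_at_imp_continuous_at_within)
  with assms show ?thesis by simp
qed

lemma emeasure_path_measure_point: "emeasure (path_measure T A \<omega>) {t} = 0"
proof -
  have "emeasure (path_measure T A \<omega>) {t..t} = 0"
    unfolding path_measure_def
    using extended_path_mono extended_path_continuous
    by (subst emeasure_interval_measure_Icc) auto
  then show ?thesis by simp
qed

lemma AE_path_measure_neq: "AE s in path_measure T A \<omega>. s \<noteq> t"
  by (rule AE_I[of _ _ "{t}"]) (auto simp: emeasure_path_measure_point sets_path_measure)

context
  fixes f :: "real \<Rightarrow> real"
  assumes f: "set_integrable (path_measure T A \<omega>) {0<..T} f"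
begin

lemma path_integrable_subset:
  "0 \<le> s \<Longrightarrow> t \<le> T \<Longrightarrow> set_integrable (path_measure T A \<omega>) {s<..t} f"
  by (rule set_integrable_subset[OF f]) (auto simp: sets_path_measure)

lemma path_integral_increment:
  assumes "0 \<le> s" "s \<le> t" "t \<le> T"
  shows "(LINT u:{0<..t}|path_measure T A \<omega>. f u) - (LINT u:{0<..s}|path_measure T A \<omega>. f u) =
    (LINT u:{s<..t}|path_measure T A \<omega>. f u)"
proof -
  have eq: "{0<..t} = {0<..s} \<union> {s<..t}" using assms by auto
  show ?thesis unfolding eq using assms
    by (subst set_integral_Un) (auto intro!: path_integrable_subset)
qed

text \<open>
  The clock has no atoms, so an inequality on the open interval suffices. This matters at
  passage times, where the sign of the integrand is controlled only strictly before the end point.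
\<close>

lemma path_integral_mono:
  assumes g: "set_integrable (path_measure T A \<omega>) {0<..T} g"
    and st: "0 \<le> s" "s \<le> t" "t \<le> T" and le: "\<And>u. s < u \<Longrightarrow> u < t \<Longrightarrow> f u \<le> g u"
  shows "(LINT u:{s<..t}|path_measure T A \<omega>. f u) \<le> (LINT u:{s<..t}|path_measure T A \<omega>. g u)"
proof (rule set_integral_mono_AE)
  show "set_integrable (path_measure T A \<omega>) {s<..t} f"
    using st by (intro path_integrable_subset)
  show "set_integrable (path_measure T A \<omega>) {s<..t} g"
    using st by (intro set_integrable_subset[OF g]) (auto simp: sets_path_measure)
  show "AE u\<in>{s<..t} in path_measure T A \<omega>. f u \<le> g u"
    using AE_path_measure_neq[of t] by eventually_elim (auto intro: le)
qed

lemma path_integral_ge: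
  assumes st: "0 \<le> s" "s \<le> t" "t \<le> T" and ge: "\<And>u. s < u \<Longrightarrow> u < t \<Longrightarrow> c \<le> f u"
  shows "c * (A t \<omega> - A s \<omega>) \<le> (LINT u:{s<..t}|path_measure T A \<omega>. f u)"
proof -
  have mA: "A s \<omega> \<le> A t \<omega>" using mono st by (auto simp: mono_on_def)
  have fin: "emeasure (path_measure T A \<omega>) {s<..t} < \<infinity>"
    using st by (simp add: emeasure_path_measure_Ioc)
  have int: "set_integrable (path_measure T A \<omega>) {s<..t} (\<lambda>_. c)"
    unfolding set_integrable_def using fin
    by (intro integrable_scaleR_left integrable_real_indicator) (auto simp: sets_path_measure)
  have "(LINT u:{s<..t}|path_measure T A \<omega>. c) \<le> (LINT u:{s<..t}|path_measure T A \<omega>. f u)"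
  proof (rule set_integral_mono_AE[OF int])
    show "set_integrable (path_measure T A \<omega>) {s<..t} f"
      using st by (intro path_integrable_subset)
    show "AE u\<in>{s<..t} in path_measure T A \<omega>. c \<le> f u"
      using AE_path_measure_neq[of t] by eventually_elim (auto intro: ge)
  qed
  also have "(LINT u:{s<..t}|path_measure T A \<omega>. c) = c * (A t \<omega> - A s \<omega>)"
    using fin st mA
    by (simp add: set_integral_const sets_path_measure measure_def emeasure_path_measure_Ioc)
  finally show ?thesis by (simp add: mult.commute)
qed

lemma path_integral_pos_imp:
  assumes st: "0 \<le> s" "s \<le> t" "t \<le> T"
    and pos: "0 < (LINT u:{s<..t}|path_measure T A \<omega>. f u)"
  shows "A s \<omega> < A t \<omega>" and "\<exists>u. s < u \<and> u \<le> t \<and> 0 < f u"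
proof -
  have mA: "A s \<omega> \<le> A t \<omega>" using mono st by (auto simp: mono_on_def)
  show "A s \<omega> < A t \<omega>"
  proof (rule ccontr)
    assume "\<not> A s \<omega> < A t \<omega>"
    then have "emeasure (path_measure T A \<omega>) {s<..t} = 0"
      using st mA by (simp add: emeasure_path_measure_Ioc)
    then have "AE u in path_measure T A \<omega>. u \<notin> {s<..t}"
      by (intro AE_not_in) (auto simp: sets_path_measure null_sets_def)
    then have "(LINT u:{s<..t}|path_measure T A \<omega>. f u) = (LINT u|path_measure T A \<omega>. 0)"
      unfolding set_lebesgue_integral_def
      using path_integrable_subset[OF st(1,3)]
      by (intro integral_cong_AE) (auto simp: set_integrable_def)
    with pos show False by simp
  qed
  show "\<exists>u. s < u \<and> u \<le> t \<and> 0 < f u"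
  proof (rule ccontr)
    assume "\<not> ?thesis"
    then have "f u \<le> 0" if "s < u" "u < t" for u using that by (meson less_le_not_le linorder_not_less)
    then have "(LINT u:{s<..t}|path_measure T A \<omega>. f u) \<le> (LINT u:{s<..t}|path_measure T A \<omega>. 0)"
      using st by (intro path_integral_mono) (auto simp: set_integrable_def)
    with pos show False by simp
  qed
qed

end
end

section \<open>Stopping times under the usual conditions\<close>

locale usual_prob_space = prob_space P for P :: "'a measure" +
  fixes F :: "real \<Rightarrow> 'a measure" and T :: real
  assumes T_pos: "0 < T" and usual: "usual_filtration P F T"
begin

lemma space_F [simp]: "space (F t) = space P"
  using usual by (auto simp: usual_filtration_def filtration_def)

lemma sets_F_mono: "s \<le> t \<Longrightarrow> B \<in> sets (F s) \<Longrightarrow> B \<in> sets (F t)"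
  using usual by (auto simp: usual_filtration_def filtration_def)

lemma subalgebra_F: "t \<in> {0..T} \<Longrightarrow> subalgebra P (F t)"
  using usual by (auto simp: usual_filtration_def)

lemma sets_F_imp_sets: "t \<in> {0..T} \<Longrightarrow> B \<in> sets (F t) \<Longrightarrow> B \<in> sets P"
  using subalgebra_F by (auto simp: subalgebra_def)

lemma measurable_F_imp_measurable:
  "t \<in> {0..T} \<Longrightarrow> f \<in> borel_measurable (F t) \<Longrightarrow> f \<in> borel_measurable P"
  using subalgebra_F by (rule measurable_from_subalg)

lemma adapted_imp_measurable:
  "adapted F T X \<Longrightarrow> t \<in> {0..T} \<Longrightarrow> X t \<in> borel_measurable P"
  by (rule measurable_F_imp_measurable) (auto simp: adapted_def)

lemma measurable_F_mono:
  "s \<le> t \<Longrightarrow> f \<in> borel_measurable (F s) \<Longrightarrow> f \<in> borel_measurable (F t)"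
  by (rule measurable_from_subalg) (auto simp: subalgebra_def intro: sets_F_mono)

lemma sigma_finite_subalgebra_F: "t \<in> {0..T} \<Longrightarrow> sigma_finite_subalgebra P (F t)"
  by (intro finite_measure_subalgebra_is_sigma_finite)
     (simp add: finite_measure_subalgebra_def finite_measure_subalgebra_axioms_def
        subalgebra_F finite_measure_axioms)

lemma sets_F_right:
  "0 \<le> t \<Longrightarrow> t < T \<Longrightarrow> (\<And>s. t < s \<Longrightarrow> s \<le> T \<Longrightarrow> B \<in> sets (F s)) \<Longrightarrow> B \<in> sets (F t)"
  using usual by (auto simp: usual_filtration_def)

lemma subset_null_sets: "N \<in> null_sets P \<Longrightarrow> N' \<subseteq> N \<Longrightarrow> N' \<in> sets P"
  using usual T_pos sets_F_imp_sets[of 0] by (auto simp: usual_filtration_def)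

text \<open>
  The usual conditions make \<open>P\<close> complete, so random variables defined by limits of paths that are
  right-continuous only almost surely are still measurable.
\<close>

lemma borel_measurable_AE_eq:
  fixes f g :: "'a \<Rightarrow> 'b::topological_space"
  assumes g: "g \<in> borel_measurable P" and eq: "AE \<omega> in P. f \<omega> = g \<omega>"
  shows "f \<in> borel_measurable P"
proof (rule measurableI)
  obtain N where N: "N \<in> null_sets P" "{\<omega> \<in> space P. f \<omega> \<noteq> g \<omega>} \<subseteq> N"
    using eq by (auto elim!: AE_E simp: null_sets_def)
  fix B :: "'b set" assume B: "B \<in> sets borel"
  have "f -` B \<inter> space P = ((g -` B \<inter> space P) - N) \<union> (f -` B \<inter> space P \<inter> N)"
    using N(2) by auto
  also have "\<dots> \<in> sets P"
    using N(1) measurable_sets[OF g B] subset_null_sets[OF N(1), of "f -` B \<inter> space P \<inter> N"]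
    by auto
  finally show "f -` B \<inter> space P \<in> sets P" .
qed simp

lemma stopping_timesI:
  assumes "\<And>\<omega>. \<omega> \<in> space P \<Longrightarrow> 0 \<le> \<sigma> \<omega>" "\<And>\<omega>. \<omega> \<in> space P \<Longrightarrow> \<sigma> \<omega> \<le> T"
    and "\<And>t. 0 \<le> t \<Longrightarrow> t < T \<Longrightarrow> {\<omega> \<in> space P. \<sigma> \<omega> \<le> t} \<in> sets (F t)"
  shows "\<sigma> \<in> stopping_times P F T"
proof -
  have "{\<omega> \<in> space P. \<sigma> \<omega> \<le> t} \<in> sets (F t)" for t
  proof -
    consider "t < 0" | "0 \<le> t" "t < T" | "T \<le> t" by linarith
    then show ?thesis
    proof cases
      case 1
      then have "{\<omega> \<in> space P. \<sigma> \<omega> \<le> t} = {}" using assms(1) by force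
      then show ?thesis by (metis sets.empty_sets)
    next
      case 3
      then have "{\<omega> \<in> space P. \<sigma> \<omega> \<le> t} = space (F t)" using assms(2) by force
      then show ?thesis by (metis sets.top)
    qed (rule assms(3))
  qed
  then show ?thesis
    using assms(1,2) by (auto simp: stopping_times_def stopping_time_def pred_def)
qed

lemma stopping_times_sets_le:
  "\<sigma> \<in> stopping_times P F T \<Longrightarrow> {\<omega> \<in> space P. \<sigma> \<omega> \<le> t} \<in> sets (F t)"
  by (auto simp: stopping_times_def stopping_time_def pred_def)

lemma stopping_times_bounds:
  "\<sigma> \<in> stopping_times P F T \<Longrightarrow> \<omega> \<in> space P \<Longrightarrow> 0 \<le> \<sigma> \<omega> \<and> \<sigma> \<omega> \<le> T"
  by (auto simp: stopping_times_def)

lemma stopping_times_sets_eq: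
  assumes \<sigma>: "\<sigma> \<in> stopping_times P F T"
  shows "{\<omega> \<in> space P. \<sigma> \<omega> = t} \<in> sets (F t)"
proof -
  have "{\<omega> \<in> space P. \<sigma> \<omega> = t} =
      {\<omega> \<in> space P. \<sigma> \<omega> \<le> t} - (\<Union>q\<in>{q \<in> \<rat>. q < t}. {\<omega> \<in> space P. \<sigma> \<omega> \<le> q})"
  proof (intro equalityI subsetI)
    fix \<omega> assume \<omega>: "\<omega> \<in> {\<omega> \<in> space P. \<sigma> \<omega> \<le> t} - (\<Union>q\<in>{q \<in> \<rat>. q < t}. {\<omega> \<in> space P. \<sigma> \<omega> \<le> q})"
    have "\<not> \<sigma> \<omega> < t"
    proof
      assume "\<sigma> \<omega> < t"
      then obtain q where "q \<in> \<rat>" "\<sigma> \<omega> < q" "q < t" using Rats_dense_in_real by blast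
      then show False using \<omega> by auto
    qed
    then show "\<omega> \<in> {\<omega> \<in> space P. \<sigma> \<omega> = t}" using \<omega> by auto
  qed auto
  also have "\<dots> \<in> sets (F t)"
    using \<sigma> by (intro sets.Diff sets.countable_UN' stopping_times_sets_le)
      (auto intro: countable_subset[OF _ countable_rat] sets_F_mono[OF _ stopping_times_sets_le])
  finally show ?thesis .
qed

lemma stopping_times_measurable: "\<sigma> \<in> stopping_times P F T \<Longrightarrow> \<sigma> \<in> borel_measurable P"
proof (rule borel_measurableI_le)
  fix t assume \<sigma>: "\<sigma> \<in> stopping_times P F T"
  consider "t < 0" | "t \<in> {0..T}" | "T < t" by force
  then show "{\<omega> \<in> space P. \<sigma> \<omega> \<le> t} \<in> sets P"
  proof cases
    case 1
    then have "{\<omega> \<in> space P. \<sigma> \<omega> \<le> t} = {}" using stopping_times_bounds[OF \<sigma>] by force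
    then show ?thesis by (metis sets.empty_sets)
  next
    case 2
    then show ?thesis using stopping_times_sets_le[OF \<sigma>] sets_F_imp_sets by blast
  next
    case 3
    then have "{\<omega> \<in> space P. \<sigma> \<omega> \<le> t} = space P" using stopping_times_bounds[OF \<sigma>] by force
    then show ?thesis by (metis sets.top)
  qed
qed

lemma const_stopping_times: "t \<in> {0..T} \<Longrightarrow> (\<lambda>_. t) \<in> stopping_times P F T"
  by (auto simp: stopping_times_def stopping_time_const)

text \<open>
  The event \<open>r < s\<close> is a countable union over rational times before \<open>s\<close>; right-continuity of the
  filtration turns the strict inequality into the weak one.
\<close>

lemma passage_time_stopping_times:
  assumes a: "a \<in> stopping_times P F T" and X: "adapted F T X"
  shows "(\<lambda>\<omega>. passage_time T (a \<omega>) (\<lambda>t. X t \<omega>) c) \<in> stopping_times P F T"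
    (is "?r \<in> _")
proof (rule stopping_timesI)
  fix t assume t: "0 \<le> t" "t < T"
  have less: "{\<omega> \<in> space P. ?r \<omega> < s} \<in> sets (F s)" if s: "s \<le> T" for s
  proof -
    have "{\<omega> \<in> space P. ?r \<omega> < s} =
        (\<Union>q\<in>{q \<in> \<rat>. 0 \<le> q \<and> q < s}. {\<omega> \<in> space P. a \<omega> \<le> q} \<inter> {\<omega> \<in> space P. c < X q \<omega>})"
    proof (intro equalityI subsetI)
      fix \<omega> assume \<omega>: "\<omega> \<in> {\<omega> \<in> space P. ?r \<omega> < s}"
      then obtain q where "q \<in> \<rat>" "a \<omega> \<le> q" "q < s" "c < X q \<omega>"
        by (auto simp: passage_time_less_iff[OF s])
      moreover have "0 \<le> a \<omega>" using stopping_times_bounds[OF a] \<omega> by auto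
      ultimately show "\<omega> \<in> (\<Union>q\<in>{q \<in> \<rat>. 0 \<le> q \<and> q < s}. {\<omega> \<in> space P. a \<omega> \<le> q} \<inter> {\<omega> \<in> space P. c < X q \<omega>})"
        using \<omega> by auto
    qed (auto simp: passage_time_less_iff[OF s])
    also have "\<dots> \<in> sets (F s)"
    proof (rule sets.countable_UN')
      show "countable {q \<in> \<rat>. 0 \<le> q \<and> q < s}"
        by (rule countable_subset[OF _ countable_rat]) auto
      show "(\<lambda>q. {\<omega> \<in> space P. a \<omega> \<le> q} \<inter> {\<omega> \<in> space P. c < X q \<omega>}) `
          {q \<in> \<rat>. 0 \<le> q \<and> q < s} \<subseteq> sets (F s)"
      proof clarify
        fix q :: real assume q: "0 \<le> q" "q < s"
        have "X q \<in> borel_measurable (F q)" using X q s by (auto simp: adapted_def)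
        then have "{\<omega> \<in> space (F q). c < X q \<omega>} \<in> sets (F q)" by (rule borel_measurable_less[OF borel_measurable_const])
        then have "{\<omega> \<in> space P. a \<omega> \<le> q} \<inter> {\<omega> \<in> space P. c < X q \<omega>} \<in> sets (F q)"
          using stopping_times_sets_le[OF a, of q] by (simp only: space_F sets.Int)
        then show "{\<omega> \<in> space P. a \<omega> \<le> q} \<inter> {\<omega> \<in> space P. c < X q \<omega>} \<in> sets (F s)"
          using q by (intro sets_F_mono[of q s]) simp_all
      qed
    qed
    finally show ?thesis .
  qed
  show "{\<omega> \<in> space P. ?r \<omega> \<le> t} \<in> sets (F t)"
  proof (rule sets_F_right[OF t])
    fix s assume s: "t < s" "s \<le> T"
    have "{\<omega> \<in> space P. ?r \<omega> \<le> t} = (\<Inter>u\<in>\<rat> \<inter> {t<..s}. {\<omega> \<in> space P. ?r \<omega> < u})"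
    proof (intro equalityI subsetI)
      fix \<omega> assume \<omega>: "\<omega> \<in> (\<Inter>u\<in>\<rat> \<inter> {t<..s}. {\<omega> \<in> space P. ?r \<omega> < u})"
      obtain u where "u \<in> \<rat>" "t < u" "u < s" using Rats_dense_in_real[OF s(1)] by auto
      then have "u \<in> \<rat> \<inter> {t<..s}" by auto
      then have "\<omega> \<in> space P" using \<omega> by blast
      moreover have "?r \<omega> \<le> t"
      proof (rule ccontr)
        assume "\<not> ?r \<omega> \<le> t"
        then obtain u where u: "u \<in> \<rat>" "t < u" "u < min s (?r \<omega>)"
          using Rats_dense_in_real[of t "min s (?r \<omega>)"] s by auto
        then have "u \<in> \<rat> \<inter> {t<..s}" by auto
        then have "?r \<omega> < u" using \<omega> by blast
        then show False using u by auto
      qed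
      ultimately show "\<omega> \<in> {\<omega> \<in> space P. ?r \<omega> \<le> t}" by simp
    qed auto
    also have "\<dots> \<in> sets (F s)"
    proof (rule sets.countable_INT')
      show "countable (\<rat> \<inter> {t<..s})"
        by (rule countable_subset[OF _ countable_rat]) auto
      show "\<rat> \<inter> {t<..s} \<noteq> {}" using Rats_dense_in_real[OF s(1)] by force
      show "(\<lambda>u. {\<omega> \<in> space P. ?r \<omega> < u}) ` (\<rat> \<inter> {t<..s}) \<subseteq> sets (F s)"
      proof clarify
        fix u assume u: "u \<in> {t<..s}"
        then have "{\<omega> \<in> space P. ?r \<omega> < u} \<in> sets (F u)" using s(2) by (intro less) auto
        then show "{\<omega> \<in> space P. ?r \<omega> < u} \<in> sets (F s)" using u by (intro sets_F_mono[of u s]) simp_all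
      qed
    qed
    finally show "{\<omega> \<in> space P. ?r \<omega> \<le> t} \<in> sets (F s)" .
  qed
next
  fix \<omega> assume "\<omega> \<in> space P"
  then have "0 \<le> a \<omega>" "a \<omega> \<le> T" using stopping_times_bounds[OF a] by auto
  then show "0 \<le> ?r \<omega>"
    using passage_time_ge[of "a \<omega>" T "\<lambda>t. X t \<omega>" c] by linarith
  show "?r \<omega> \<le> T" by (rule passage_time_le)
qed

text \<open>
  Sections at a fixed time of the generators of the optional \<open>\<sigma>\<close>-algebra are events of \<open>F t\<close>.
\<close>

lemma optional_imp_adapted:
  fixes X :: "real \<Rightarrow> 'a \<Rightarrow> real"
  assumes X: "optional P F T X"
  shows "adapted F T X"
  unfolding adapted_def
proof
  fix t assume t: "t \<in> {0..T}"
  have "(\<lambda>\<omega>. (t, \<omega>)) \<in> measurable (F t) (optional_sigma P F T)"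
    unfolding optional_sigma_def
  proof (rule measurable_measure_of)
    show "(\<lambda>\<omega>. (t, \<omega>)) \<in> space (F t) \<rightarrow> {0..T} \<times> space P" using t by simp
    fix S assume "S \<in> {{(t, \<omega>) \<in> {0..T} \<times> space P. X t \<omega> \<in> B} |(X :: real \<Rightarrow> 'a \<Rightarrow> real) B.
        adapted F T X \<and> (\<forall>\<omega>\<in>space P. cadlag_path T (\<lambda>t. X t \<omega>)) \<and> B \<in> sets borel}"
    then obtain W :: "real \<Rightarrow> 'a \<Rightarrow> real" and B where W: "adapted F T W" "B \<in> sets borel"
        and S: "S = {(t, \<omega>) \<in> {0..T} \<times> space P. W t \<omega> \<in> B}"
      by blast
    have "(\<lambda>\<omega>. (t, \<omega>)) -` S \<inter> space (F t) = W t -` B \<inter> space (F t)"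
      using t by (auto simp: S)
    also have "\<dots> \<in> sets (F t)" using W t by (intro measurable_sets) (auto simp: adapted_def)
    finally show "(\<lambda>\<omega>. (t, \<omega>)) -` S \<inter> space (F t) \<in> sets (F t)" .
  qed auto
  then have "(\<lambda>\<omega>. case (t, \<omega>) of (t, \<omega>) \<Rightarrow> X t \<omega>) \<in> borel_measurable (F t)"
    using X unfolding optional_def by (rule measurable_compose)
  then show "X t \<in> borel_measurable (F t)" by simp
qed

section \<open>Optional stopping for dominated processes\<close>

text \<open>
  The least multiple of \<open>T / (k + 1)\<close> that is not below \<open>s\<close>. As \<open>T\<close> itself is on the grid, rounding
  up does not leave \<open>[0, T]\<close>.
\<close>

definition grid_ceiling :: "nat \<Rightarrow> real \<Rightarrow> real" where
  "grid_ceiling k s = T / Suc k * \<lceil>s * Suc k / T\<rceil>"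

lemma grid_ceiling_le_iff: "grid_ceiling k s \<le> u \<longleftrightarrow> s \<le> T / Suc k * \<lfloor>u * Suc k / T\<rfloor>"
proof -
  have "grid_ceiling k s \<le> u \<longleftrightarrow> real_of_int \<lceil>s * Suc k / T\<rceil> \<le> u * Suc k / T"
    using T_pos by (simp add: grid_ceiling_def field_simps)
  also have "\<dots> \<longleftrightarrow> s * Suc k / T \<le> \<lfloor>u * Suc k / T\<rfloor>"
    by (simp add: le_floor_iff ceiling_le_iff flip: le_floor_iff)
  also have "\<dots> \<longleftrightarrow> s \<le> T / Suc k * \<lfloor>u * Suc k / T\<rfloor>"
    using T_pos by (simp add: field_simps)
  finally show ?thesis .
qed

lemma grid_ceiling_ge: "s \<le> grid_ceiling k s"
proof -
  define c where "c = real_of_int \<lceil>s * Suc k / T\<rceil>"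
  have "s * Suc k / T \<le> c" unfolding c_def by (rule le_of_int_ceiling)
  then have "s \<le> T / Suc k * c" using T_pos by (simp add: field_simps)
  then show ?thesis by (simp add: grid_ceiling_def c_def)
qed

lemma grid_ceiling_upper: "grid_ceiling k s \<le> s + T / Suc k"
proof -
  define c where "c = real_of_int \<lceil>s * Suc k / T\<rceil>"
  have "c \<le> s * Suc k / T + 1" unfolding c_def by linarith
  then have "T / Suc k * c \<le> T / Suc k * (s * Suc k / T + 1)"
    using T_pos by (intro mult_left_mono) auto
  also have "\<dots> = s + T / Suc k" using T_pos by (simp add: field_simps del: of_nat_Suc)
  finally have "T / Suc k * c \<le> s + T / Suc k" .
  then show ?thesis by (simp add: grid_ceiling_def c_def)
qed

lemma grid_ceiling_LIMSEQ: "(\<lambda>k. grid_ceiling k s) \<longlonglongrightarrow> s"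
proof (rule tendsto_sandwich[of "\<lambda>_. s"])
  have "(\<lambda>k. s + T * inverse (real (Suc k))) \<longlonglongrightarrow> s + T * 0"
    by (intro tendsto_intros LIMSEQ_inverse_real_of_nat)
  then show "(\<lambda>k. s + T / Suc k) \<longlonglongrightarrow> s" by (simp add: divide_inverse)
qed (use grid_ceiling_ge grid_ceiling_upper in auto)

lemma grid_ceiling_grid:
  assumes "0 \<le> s" "s \<le> T"
  obtains j where "j \<le> Suc k" "grid_ceiling k s = T / Suc k * real j"
proof
  have "0 \<le> s * Suc k / T" using assms T_pos by simp
  then have 0: "0 \<le> \<lceil>s * Suc k / T\<rceil>" by linarith
  have "s * real (Suc k) \<le> T * real (Suc k)" using assms by (intro mult_right_mono) auto
  then have "s * Suc k / T \<le> Suc k" using T_pos by (simp add: pos_divide_le_eq mult.commute)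
  then have "\<lceil>s * Suc k / T\<rceil> \<le> int (Suc k)" by (simp add: ceiling_le_iff)
  then show "nat \<lceil>s * Suc k / T\<rceil> \<le> Suc k" by (simp only: nat_le_iff)
  show "grid_ceiling k s = T / Suc k * real (nat \<lceil>s * Suc k / T\<rceil>)"
    using 0 by (simp add: grid_ceiling_def)
qed

lemma grid_point_bounds: "j \<le> Suc k \<Longrightarrow> T / Suc k * real j \<in> {0..T}"
  using T_pos mult_left_mono[of "real j" "real (Suc k)" T] by (simp add: field_simps)

lemma grid_ceiling_bounds: "0 \<le> s \<Longrightarrow> s \<le> T \<Longrightarrow> grid_ceiling k s \<le> T"
  using grid_ceiling_grid[of s k] grid_point_bounds[of _ k] by (metis atLeastAtMost_iff)

text \<open>
  Rounding up looks only into the past: the rounded time is at most \<open>t\<close> exactly when the original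
  one is at most the last grid point before \<open>t\<close>.
\<close>

lemma grid_ceiling_stopping_times:
  assumes \<sigma>: "\<sigma> \<in> stopping_times P F T"
  shows "(\<lambda>\<omega>. grid_ceiling k (\<sigma> \<omega>)) \<in> stopping_times P F T"
proof (rule stopping_timesI)
  fix \<omega> assume "\<omega> \<in> space P"
  then have b: "0 \<le> \<sigma> \<omega>" "\<sigma> \<omega> \<le> T" using stopping_times_bounds[OF \<sigma>] by auto
  show "0 \<le> grid_ceiling k (\<sigma> \<omega>)" using grid_ceiling_ge[of "\<sigma> \<omega>" k] b by linarith
  show "grid_ceiling k (\<sigma> \<omega>) \<le> T" using b by (rule grid_ceiling_bounds)
next
  fix t :: real
  let ?u = "T / Suc k * \<lfloor>t * Suc k / T\<rfloor>"
  have "?u \<le> T / Suc k * (t * Suc k / T)"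
    using T_pos by (intro mult_left_mono of_int_floor_le) simp
  then have "?u \<le> t" using T_pos by simp
  then have "{\<omega> \<in> space P. \<sigma> \<omega> \<le> ?u} \<in> sets (F t)"
    by (rule sets_F_mono[OF _ stopping_times_sets_le[OF \<sigma>]])
  then show "{\<omega> \<in> space P. grid_ceiling k (\<sigma> \<omega>) \<le> t} \<in> sets (F t)"
    by (simp only: grid_ceiling_le_iff)
qed

lemma grid_value_sum:
  fixes X :: "real \<Rightarrow> 'a \<Rightarrow> real"
  assumes \<sigma>: "\<sigma> \<in> stopping_times P F T" and \<omega>: "\<omega> \<in> space P"
  shows "X (grid_ceiling k (\<sigma> \<omega>)) \<omega> =
    (\<Sum>j\<le>Suc k. indicator {\<omega> \<in> space P. grid_ceiling k (\<sigma> \<omega>) = T / Suc k * real j} \<omega>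
      * X (T / Suc k * real j) \<omega>)"
proof -
  have "0 \<le> \<sigma> \<omega>" "\<sigma> \<omega> \<le> T" using stopping_times_bounds[OF \<sigma> \<omega>] by auto
  then obtain i where i: "i \<le> Suc k" "grid_ceiling k (\<sigma> \<omega>) = T / Suc k * real i"
    by (rule grid_ceiling_grid)
  have "(\<Sum>j\<le>Suc k. indicator {\<omega> \<in> space P. grid_ceiling k (\<sigma> \<omega>) = T / Suc k * real j} \<omega>
      * X (T / Suc k * real j) \<omega>) = (\<Sum>j\<le>Suc k. if j = i then X (T / Suc k * real j) \<omega> else 0)"
    using T_pos \<omega> i(2) by (intro sum.cong) (auto simp: indicator_def)
  also have "\<dots> = X (T / Suc k * real i) \<omega>" using i(1) by (subst sum.delta) auto
  finally show ?thesis using i(2) by simp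
qed

lemma grid_value_measurable:
  fixes X :: "real \<Rightarrow> 'a \<Rightarrow> real"
  assumes \<sigma>: "\<sigma> \<in> stopping_times P F T" and X: "adapted F T X"
  shows "(\<lambda>\<omega>. X (grid_ceiling k (\<sigma> \<omega>)) \<omega>) \<in> borel_measurable P"
proof (subst measurable_cong[OF grid_value_sum[OF \<sigma>]], assumption)
  have "X (T / Suc k * real j) \<in> borel_measurable P" if "j \<le> Suc k" for j
    by (rule adapted_imp_measurable[OF X grid_point_bounds[OF that]])
  moreover have "{\<omega> \<in> space P. grid_ceiling k (\<sigma> \<omega>) = T / Suc k * real j} \<in> sets P"
    if "j \<le> Suc k" for j
    using stopping_times_sets_eq[OF grid_ceiling_stopping_times[OF \<sigma>]] sets_F_imp_sets
      grid_point_bounds[OF that] by blast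
  ultimately show "(\<lambda>\<omega>. \<Sum>j\<le>Suc k.
      indicator {\<omega> \<in> space P. grid_ceiling k (\<sigma> \<omega>) = T / Suc k * real j} \<omega>
      * X (T / Suc k * real j) \<omega>) \<in> borel_measurable P"
    by (intro borel_measurable_sum borel_measurable_times borel_measurable_indicator) auto
qed

lemma grid_value_LIMSEQ:
  assumes \<sigma>: "\<sigma> \<in> stopping_times P F T"
    and rc: "AE \<omega> in P. right_cont_path T (\<lambda>t. X t \<omega>)"
  shows "AE \<omega> in P. (\<lambda>k. X (grid_ceiling k (\<sigma> \<omega>)) \<omega>) \<longlonglongrightarrow> X (\<sigma> \<omega>) \<omega>"
  using rc AE_space
proof eventually_elim
  case (elim \<omega>)
  then have "0 \<le> \<sigma> \<omega>" "\<sigma> \<omega> \<le> T" using stopping_times_bounds[OF \<sigma>] by auto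
  then show ?case
    by (intro right_cont_path_sequence[OF elim(1)] grid_ceiling_ge grid_ceiling_bounds
        grid_ceiling_LIMSEQ)
qed

lemma stopped_value_measurable:
  fixes X :: "real \<Rightarrow> 'a \<Rightarrow> real"
  assumes \<sigma>: "\<sigma> \<in> stopping_times P F T" and X: "adapted F T X"
    and rc: "AE \<omega> in P. right_cont_path T (\<lambda>t. X t \<omega>)"
  shows "(\<lambda>\<omega>. X (\<sigma> \<omega>) \<omega>) \<in> borel_measurable P"
proof (rule borel_measurable_AE_eq)
  show "(\<lambda>\<omega>. lim (\<lambda>k. X (grid_ceiling k (\<sigma> \<omega>)) \<omega>)) \<in> borel_measurable P"
    by (intro borel_measurable_lim_metric grid_value_measurable \<sigma> X)
  show "AE \<omega> in P. X (\<sigma> \<omega>) \<omega> = lim (\<lambda>k. X (grid_ceiling k (\<sigma> \<omega>)) \<omega>)"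
    using grid_value_LIMSEQ[OF \<sigma> rc] by eventually_elim (simp add: limI)
qed

text \<open>
  For a time on a finite grid the integral splits over the events on which a given grid point is
  attained, and on each of them the martingale property applies. Rounding a general stopping time
  up and refining the grid gives the result by right-continuity and dominated convergence. The
  domination by one integrable variable replaces the uniform integrability of the values at the
  grid times.
\<close>

lemma optional_stopping:
  fixes X :: "real \<Rightarrow> 'a \<Rightarrow> real"
  assumes X: "adapted F T X" and rc: "AE \<omega> in P. right_cont_path T (\<lambda>t. X t \<omega>)"
    and mart: "\<And>s C. s \<in> {0..T} \<Longrightarrow> C \<in> sets (F s) \<Longrightarrow>
      (LINT \<omega>:C|P. X s \<omega>) = (LINT \<omega>:C|P. X T \<omega>)"
    and H: "integrable P H" "\<And>\<sigma>. \<sigma> \<in> stopping_times P F T \<Longrightarrow> AE \<omega> in P. \<bar>X (\<sigma> \<omega>) \<omega>\<bar> \<le> H \<omega>"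
    and \<sigma>: "\<sigma> \<in> stopping_times P F T" and t: "t \<in> {0..T}"
    and t_le: "\<And>\<omega>. \<omega> \<in> space P \<Longrightarrow> t \<le> \<sigma> \<omega>" and B: "B \<in> sets (F t)"
  shows "(LINT \<omega>:B|P. X (\<sigma> \<omega>) \<omega>) = (LINT \<omega>:B|P. X t \<omega>)"
proof -
  have BP: "B \<in> sets P" using B t sets_F_imp_sets by blast
  have int: "integrable P (X s)" if "s \<in> {0..T}" for s
  proof (rule Bochner_Integration.integrable_bound[OF H(1)])
    show "X s \<in> borel_measurable P" by (rule adapted_imp_measurable[OF X that])
    show "AE \<omega> in P. norm (X s \<omega>) \<le> norm (H \<omega>)"
      using H(2)[OF const_stopping_times[OF that]] by eventually_elim auto
  qed
  have grid: "(LINT \<omega>:B|P. X (grid_ceiling k (\<sigma> \<omega>)) \<omega>) = (LINT \<omega>:B|P. X T \<omega>)" for k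
  proof -
    define p where "p j = T / Suc k * real j" for j
    define E where "E j = B \<inter> {\<omega> \<in> space P. grid_ceiling k (\<sigma> \<omega>) = p j}" for j
    have p: "p j \<in> {0..T}" if "j \<le> Suc k" for j
      using grid_point_bounds[OF that] by (simp add: p_def)
    have E: "E j \<in> sets (F (p j))" for j
    proof (cases "t \<le> p j")
      case True
      then show ?thesis
        unfolding E_def
        by (intro sets.Int sets_F_mono[OF _ B]
            stopping_times_sets_eq[OF grid_ceiling_stopping_times[OF \<sigma>]])
    next
      case False
      have "t \<le> grid_ceiling k (\<sigma> \<omega>)" if "\<omega> \<in> space P" for \<omega>
        using t_le[OF that] grid_ceiling_ge[of "\<sigma> \<omega>" k] by linarith
      with False have "E j = {}" by (force simp: E_def)
      then show ?thesis by simp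
    qed
    have EP: "E j \<in> sets P" if "j \<le> Suc k" for j
      using sets_F_imp_sets[OF p[OF that] E] .
    have decomp: "indicator B \<omega> * X' (grid_ceiling k (\<sigma> \<omega>)) \<omega> =
        (\<Sum>j\<le>Suc k. indicator (E j) \<omega> * X' (p j) \<omega>)" if "\<omega> \<in> space P"
      for \<omega> and X' :: "real \<Rightarrow> 'a \<Rightarrow> real"
      unfolding grid_value_sum[OF \<sigma> that, of X'] sum_distrib_left
      by (intro sum.cong) (auto simp: E_def p_def indicator_def)
    have sum: "(LINT \<omega>:B|P. X' (grid_ceiling k (\<sigma> \<omega>)) \<omega>) = (\<Sum>j\<le>Suc k. (LINT \<omega>:E j|P. X' (p j) \<omega>))"
      if "\<And>j. j \<le> Suc k \<Longrightarrow> integrable P (X' (p j))" for X' :: "real \<Rightarrow> 'a \<Rightarrow> real"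
    proof -
      have "(LINT \<omega>:B|P. X' (grid_ceiling k (\<sigma> \<omega>)) \<omega>) =
          (LINT \<omega>|P. (\<Sum>j\<le>Suc k. indicator (E j) \<omega> * X' (p j) \<omega>))"
        unfolding set_lebesgue_integral_def
        by (intro Bochner_Integration.integral_cong) (auto simp: decomp)
      also have "\<dots> = (\<Sum>j\<le>Suc k. (LINT \<omega>|P. indicator (E j) \<omega> * X' (p j) \<omega>))"
        using that EP
        by (intro Bochner_Integration.integral_sum)
          (auto intro!: integrable_mult_indicator[where 'b=real, simplified])
      finally show ?thesis by (simp add: set_lebesgue_integral_def)
    qed
    have "(LINT \<omega>:B|P. X (grid_ceiling k (\<sigma> \<omega>)) \<omega>) = (\<Sum>j\<le>Suc k. (LINT \<omega>:E j|P. X (p j) \<omega>))"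
      using int p by (intro sum) auto
    also have "\<dots> = (\<Sum>j\<le>Suc k. (LINT \<omega>:E j|P. X T \<omega>))"
      using p E by (intro sum.cong mart) auto
    also have "\<dots> = (LINT \<omega>:B|P. X T \<omega>)"
      using int T_pos by (intro sum[of "\<lambda>_. X T", symmetric]) auto
    finally show ?thesis .
  qed
  have "(\<lambda>k. LINT \<omega>:B|P. X (grid_ceiling k (\<sigma> \<omega>)) \<omega>) \<longlonglongrightarrow> (LINT \<omega>:B|P. X (\<sigma> \<omega>) \<omega>)"
    unfolding set_lebesgue_integral_def
  proof (rule integral_dominated_convergence[where w = H])
    show "(\<lambda>\<omega>. indicat_real B \<omega> *\<^sub>R X (\<sigma> \<omega>) \<omega>) \<in> borel_measurable P"
      using BP stopped_value_measurable[OF \<sigma> X rc] by simp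
    show "(\<lambda>\<omega>. indicat_real B \<omega> *\<^sub>R X (grid_ceiling k (\<sigma> \<omega>)) \<omega>) \<in> borel_measurable P" for k
      using BP grid_value_measurable[OF \<sigma> X] by simp
    show "AE \<omega> in P. (\<lambda>k. indicat_real B \<omega> *\<^sub>R X (grid_ceiling k (\<sigma> \<omega>)) \<omega>)
        \<longlonglongrightarrow> indicat_real B \<omega> *\<^sub>R X (\<sigma> \<omega>) \<omega>"
      using grid_value_LIMSEQ[OF \<sigma> rc] by eventually_elim (intro tendsto_intros)
    show "AE \<omega> in P. norm (indicat_real B \<omega> *\<^sub>R X (grid_ceiling k (\<sigma> \<omega>)) \<omega>) \<le> H \<omega>" for k
      using H(2)[OF grid_ceiling_stopping_times[OF \<sigma>, of k]]
      by eventually_elim (auto simp: indicator_def)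
  qed (rule H(1))
  then have "(LINT \<omega>:B|P. X T \<omega>) = (LINT \<omega>:B|P. X (\<sigma> \<omega>) \<omega>)"
    unfolding grid by (simp add: LIMSEQ_const_iff)
  then show ?thesis using mart[OF t B] by simp
qed

section \<open>Comparison of conditional expectations and of paths\<close>

lemma set_integrable_sets:
  fixes f :: "'a \<Rightarrow> real"
  shows "integrable P f \<Longrightarrow> B \<in> sets P \<Longrightarrow> set_integrable P B f"
  unfolding set_integrable_def by (rule integrable_mult_indicator)

text \<open>
  The event \<open>g < f\<close> belongs to \<open>F t\<close>; on it \<open>f - g\<close> is positive but has integral at most zero.
\<close>

lemma AE_le_of_set_integrals_le:
  fixes f g :: "'a \<Rightarrow> real"
  assumes t: "t \<in> {0..T}" and f: "integrable P f" "f \<in> borel_measurable (F t)"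
    and g: "integrable P g" "g \<in> borel_measurable (F t)"
    and le: "\<And>B. B \<in> sets (F t) \<Longrightarrow> (LINT \<omega>:B|P. f \<omega>) \<le> (LINT \<omega>:B|P. g \<omega>)"
  shows "AE \<omega> in P. f \<omega> \<le> g \<omega>"
proof -
  define B where "B = {\<omega> \<in> space (F t). g \<omega> < f \<omega>}"
  have B: "B \<in> sets (F t)" unfolding B_def using f g by (intro borel_measurable_less)
  then have BP: "B \<in> sets P" using t sets_F_imp_sets by blast
  have int: "integrable P (\<lambda>\<omega>. indicat_real B \<omega> *\<^sub>R (f \<omega> - g \<omega>))"
    using f g BP by (intro integrable_mult_indicator) auto
  have nonneg: "0 \<le> indicat_real B \<omega> *\<^sub>R (f \<omega> - g \<omega>)" for \<omega>
    by (auto simp: B_def indicator_def)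
  have "(LINT \<omega>:B|P. f \<omega> - g \<omega>) = (LINT \<omega>:B|P. f \<omega>) - (LINT \<omega>:B|P. g \<omega>)"
    using f g BP by (intro set_integral_diff set_integrable_sets)
  then have "(LINT \<omega>|P. indicat_real B \<omega> *\<^sub>R (f \<omega> - g \<omega>)) \<le> 0"
    using le[OF B] by (simp add: set_lebesgue_integral_def)
  moreover have "0 \<le> (LINT \<omega>|P. indicat_real B \<omega> *\<^sub>R (f \<omega> - g \<omega>))"
    using nonneg by (intro Bochner_Integration.integral_nonneg)
  ultimately have "AE \<omega> in P. indicat_real B \<omega> *\<^sub>R (f \<omega> - g \<omega>) = 0"
    using integral_nonneg_eq_0_iff_AE[OF int] nonneg by auto
  then show ?thesis
    using AE_space by eventually_elim (auto simp: B_def indicator_def split: if_splits)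
qed

text \<open>
  One-sided versions of the characterisation of conditional expectations by integrals over events.
\<close>

lemma
  fixes f g :: "'a \<Rightarrow> real"
  assumes t: "t \<in> {0..T}" and f: "integrable P f" "f \<in> borel_measurable (F t)"
    and g: "integrable P g"
  shows le_real_cond_expI:
      "(\<And>B. B \<in> sets (F t) \<Longrightarrow> (LINT \<omega>:B|P. f \<omega>) \<le> (LINT \<omega>:B|P. g \<omega>)) \<Longrightarrow>
        AE \<omega> in P. f \<omega> \<le> real_cond_exp P (F t) g \<omega>"
    and real_cond_exp_leI:
      "(\<And>B. B \<in> sets (F t) \<Longrightarrow> (LINT \<omega>:B|P. g \<omega>) \<le> (LINT \<omega>:B|P. f \<omega>)) \<Longrightarrow>
        AE \<omega> in P. real_cond_exp P (F t) g \<omega> \<le> f \<omega>"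
proof -
  interpret E: sigma_finite_subalgebra P "F t" by (rule sigma_finite_subalgebra_F[OF t])
  note E = E.real_cond_exp_int(1)[OF g] borel_measurable_cond_exp[of P "F t" g]
  show "AE \<omega> in P. f \<omega> \<le> real_cond_exp P (F t) g \<omega>"
    if "\<And>B. B \<in> sets (F t) \<Longrightarrow> (LINT \<omega>:B|P. f \<omega>) \<le> (LINT \<omega>:B|P. g \<omega>)"
    using that by (intro AE_le_of_set_integrals_le[OF t f E]) (simp flip: E.real_cond_exp_intA[OF g])
  show "AE \<omega> in P. real_cond_exp P (F t) g \<omega> \<le> f \<omega>"
    if "\<And>B. B \<in> sets (F t) \<Longrightarrow> (LINT \<omega>:B|P. g \<omega>) \<le> (LINT \<omega>:B|P. f \<omega>)"
    using that by (intro AE_le_of_set_integrals_le[OF t E f]) (simp flip: E.real_cond_exp_intA[OF g])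
qed

text \<open>
  Rational times and \<open>T\<close> suffice: a violation before \<open>T\<close> would spread to rational times on its right.
\<close>

lemma AE_all_times_le:
  fixes X :: "real \<Rightarrow> 'a \<Rightarrow> real"
  assumes rc: "AE \<omega> in P. right_cont_path T (\<lambda>t. X t \<omega>)"
    and le: "\<And>t. t \<in> {0..T} \<Longrightarrow> AE \<omega> in P. X t \<omega> \<le> c"
  shows "AE \<omega> in P. \<forall>t\<in>{0..T}. X t \<omega> \<le> c"
proof -
  have "AE \<omega> in P. \<forall>q\<in>\<rat> \<inter> {0..T}. X q \<omega> \<le> c"
    using le by (subst AE_ball_countable) (auto intro: countable_subset[OF _ countable_rat])
  moreover have "AE \<omega> in P. X T \<omega> \<le> c" using T_pos by (intro le) auto
  ultimately show ?thesis using rc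
  proof eventually_elim
    case (elim \<omega>)
    have "X t \<omega> \<le> c" if t: "0 \<le> t" "t < T" for t
    proof (rule passage_time_before[OF elim(3) t(1)])
      show "t < passage_time T t (\<lambda>t. X t \<omega>) c"
      proof (rule ccontr)
        assume "\<not> ?thesis"
        then have "passage_time T t (\<lambda>t. X t \<omega>) c < T" using t by linarith
        then obtain q where "q \<in> \<rat>" "t \<le> q" "q < T" "c < X q \<omega>"
          using passage_time_less_iff[of T T t] by auto
        then show False using elim(1) t by force
      qed
    qed simp
    then show ?case using elim(2) by (force simp: less_le)
  qed
qed

end

section \<open>One penalized equation\<close>

lemma support_stopping_times_from_imp_stopping_times:
  "\<tau> \<in> support_stopping_times_from P F T A t \<Longrightarrow> \<tau> \<in> stopping_times P F T"
  by (simp add: support_stopping_times_from_def support_stopping_times_def)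

text \<open>
  The data without the equation. The bound \<open>K\<close> is common to the terminal value and the obstacle.
\<close>

locale penalization = usual_prob_space P F T
  for P :: "'a measure" and F :: "real \<Rightarrow> 'a measure" and T :: real +
  fixes A :: "real \<Rightarrow> 'a \<Rightarrow> real" and \<xi> :: "'a \<Rightarrow> real" and \<eta> :: "real \<Rightarrow> 'a \<Rightarrow> real" and K :: real
  assumes clock: "clock_process P F T A"
    and \<xi>_measurable: "\<xi> \<in> borel_measurable (F T)" and \<xi>_bound: "AE \<omega> in P. \<bar>\<xi> \<omega>\<bar> \<le> K"
    and \<eta>_adapted: "adapted F T \<eta>" and \<eta>_bound: "AE \<omega> in P. \<forall>t\<in>{0..T}. \<bar>\<eta> t \<omega>\<bar> \<le> K"
    and \<eta>_right_cont: "AE \<omega> in P. right_cont_path T (\<lambda>t. \<eta> t \<omega>)"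
begin

definition payoff :: "('a \<Rightarrow> real) \<Rightarrow> 'a \<Rightarrow> real" where
  "payoff \<sigma> \<omega> = \<xi> \<omega> * indicator {\<omega>. \<sigma> \<omega> = T} \<omega> + \<eta> (\<sigma> \<omega>) \<omega> * indicator {\<omega>. \<sigma> \<omega> < T} \<omega>"

definition penalty :: "nat \<Rightarrow> (real \<Rightarrow> 'a \<Rightarrow> real) \<Rightarrow> real \<Rightarrow> 'a \<Rightarrow> real" where
  "penalty n Y t \<omega> =
    (LINT s:{0<..t}|path_measure T A \<omega>. real n * max 0 (\<eta> s \<omega> - Y s \<omega>))"

lemma clock_path:
  "AE \<omega> in P. mono_on {0..T} (\<lambda>t. A t \<omega>) \<and> continuous_on {0..T} (\<lambda>t. A t \<omega>)"
  using clock unfolding clock_process_def by (auto elim: eventually_mono)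

lemma payoff_measurable:
  assumes \<sigma>: "\<sigma> \<in> stopping_times P F T"
  shows "payoff \<sigma> \<in> borel_measurable P"
proof -
  note [measurable] = stopping_times_measurable[OF \<sigma>]
    stopped_value_measurable[OF \<sigma> \<eta>_adapted \<eta>_right_cont]
  have [measurable]: "\<xi> \<in> borel_measurable P"
    using T_pos by (intro measurable_F_imp_measurable[OF _ \<xi>_measurable]) auto
  have "(\<lambda>\<omega>. \<xi> \<omega> * (if \<sigma> \<omega> = T then 1 else 0) + \<eta> (\<sigma> \<omega>) \<omega> * (if \<sigma> \<omega> < T then 1 else 0))
      \<in> borel_measurable P"
    by measurable
  then show ?thesis by (simp add: payoff_def[abs_def] indicator_def of_bool_def)
qed

lemma payoff_bound:
  assumes \<sigma>: "\<sigma> \<in> stopping_times P F T"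
  shows "AE \<omega> in P. \<bar>payoff \<sigma> \<omega>\<bar> \<le> K"
  using \<xi>_bound \<eta>_bound AE_space
proof eventually_elim
  case (elim \<omega>)
  then show ?case
    using stopping_times_bounds[OF \<sigma> elim(3)] by (auto simp: payoff_def indicator_def)
qed

lemma payoff_integrable: "\<sigma> \<in> stopping_times P F T \<Longrightarrow> integrable P (payoff \<sigma>)"
  using payoff_bound payoff_measurable by (intro integrable_const_bound[of _ K]) auto

end

text \<open>
  What a solution of the penalized equation contributes to the argument: the stochastic integral
  enters only through \<open>balance_T\<close>, the martingale property of \<open>Y\<close> plus penalty tested against the
  events of \<open>F t\<close>. The solutions for different \<open>n\<close> live on the same data, so two instances of this
  locale can be compared.
\<close>

locale penalized_solution = penalization P F T A \<xi> \<eta> K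
  for P :: "'a measure" and F :: "real \<Rightarrow> 'a measure" and T :: real
    and A :: "real \<Rightarrow> 'a \<Rightarrow> real" and \<xi> :: "'a \<Rightarrow> real" and \<eta> :: "real \<Rightarrow> 'a \<Rightarrow> real" and K :: real +
  fixes n :: nat and Y :: "real \<Rightarrow> 'a \<Rightarrow> real"
  assumes Y_adapted: "adapted F T Y"
    and Y_right_cont: "AE \<omega> in P. right_cont_path T (\<lambda>t. Y t \<omega>)"
    and Y_terminal: "AE \<omega> in P. Y T \<omega> = \<xi> \<omega>"
    and Y_dominated: "\<exists>H. integrable P H \<and>
      (\<forall>\<sigma>\<in>stopping_times P F T. AE \<omega> in P. \<bar>Y (\<sigma> \<omega>) \<omega>\<bar> \<le> H \<omega>)"
    and penalty_adapted: "adapted F T (penalty n Y)"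
    and penalty_integrand: "AE \<omega> in P. set_integrable (path_measure T A \<omega>) {0<..T}
      (\<lambda>s. real n * max 0 (\<eta> s \<omega> - Y s \<omega>))"
    and penalty_continuous: "AE \<omega> in P. continuous_on {0..T} (\<lambda>t. penalty n Y t \<omega>)"
    and penalty_integrable: "integrable P (penalty n Y T)"
    and balance_T: "\<And>t B. t \<in> {0..T} \<Longrightarrow> B \<in> sets (F t) \<Longrightarrow>
      (LINT \<omega>:B|P. Y t \<omega> + penalty n Y t \<omega>) = (LINT \<omega>:B|P. Y T \<omega> + penalty n Y T \<omega>)"
begin

abbreviation "I \<equiv> penalty n Y"

lemma penalty_0: "I 0 \<omega> = 0"
  by (simp add: penalty_def set_lebesgue_integral_def)

lemma penalty_increment:
  "AE \<omega> in P. \<forall>s t. 0 \<le> s \<longrightarrow> s \<le> t \<longrightarrow> t \<le> T \<longrightarrow>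
    I t \<omega> - I s \<omega> = (LINT u:{s<..t}|path_measure T A \<omega>. real n * max 0 (\<eta> u \<omega> - Y u \<omega>))"
  using clock_path penalty_integrand
proof eventually_elim
  case (elim \<omega>)
  then show ?case
    unfolding penalty_def using path_integral_increment[OF T_pos _ _ elim(2)] by blast
qed

lemma penalty_mono: "AE \<omega> in P. \<forall>s t. 0 \<le> s \<longrightarrow> s \<le> t \<longrightarrow> t \<le> T \<longrightarrow> I s \<omega> \<le> I t \<omega>"
  using penalty_increment
proof eventually_elim
  case (elim \<omega>)
  show ?case
  proof (intro allI impI)
    fix s t assume st: "0 \<le> s" "s \<le> t" "t \<le> T"
    have "0 \<le> I t \<omega> - I s \<omega>"
      using elim st unfolding set_lebesgue_integral_def
      by (auto intro!: Bochner_Integration.integral_nonneg)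
    then show "I s \<omega> \<le> I t \<omega>" by simp
  qed
qed

lemma penalty_right_cont: "AE \<omega> in P. right_cont_path T (\<lambda>t. I t \<omega>)"
  using penalty_continuous by eventually_elim (rule continuous_on_imp_right_cont_path)

lemma penalty_stopped_bound:
  assumes \<sigma>: "\<sigma> \<in> stopping_times P F T"
  shows "AE \<omega> in P. 0 \<le> I (\<sigma> \<omega>) \<omega> \<and> I (\<sigma> \<omega>) \<omega> \<le> I T \<omega>"
  using penalty_mono AE_space
proof eventually_elim
  case (elim \<omega>)
  have b: "0 \<le> \<sigma> \<omega>" "\<sigma> \<omega> \<le> T" using stopping_times_bounds[OF \<sigma> elim(2)] by auto
  then have "I 0 \<omega> \<le> I (\<sigma> \<omega>) \<omega>" "I (\<sigma> \<omega>) \<omega> \<le> I T \<omega>" using elim(1) by auto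
  then show ?case by (simp add: penalty_0)
qed

lemma stopped_penalty_integrable:
  assumes \<sigma>: "\<sigma> \<in> stopping_times P F T"
  shows "integrable P (\<lambda>\<omega>. I (\<sigma> \<omega>) \<omega>)"
proof (rule Bochner_Integration.integrable_bound[OF penalty_integrable])
  show "AE \<omega> in P. norm (I (\<sigma> \<omega>) \<omega>) \<le> norm (I T \<omega>)"
    using penalty_stopped_bound[OF \<sigma>] by eventually_elim auto
qed (rule stopped_value_measurable[OF \<sigma> penalty_adapted penalty_right_cont])

lemma stopped_Y_integrable:
  assumes \<sigma>: "\<sigma> \<in> stopping_times P F T"
  shows "integrable P (\<lambda>\<omega>. Y (\<sigma> \<omega>) \<omega>)"
proof -
  obtain H where H: "integrable P H" "AE \<omega> in P. \<bar>Y (\<sigma> \<omega>) \<omega>\<bar> \<le> H \<omega>"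
    using Y_dominated \<sigma> by auto
  then show ?thesis
    using stopped_value_measurable[OF \<sigma> Y_adapted Y_right_cont]
    by (intro Bochner_Integration.integrable_bound[OF H(1)]) (auto elim!: eventually_mono)
qed

text \<open>
  Optional stopping of the martingale \<open>Y + I\<close>, dominated by a bound for \<open>Y\<close> plus the total penalty.
\<close>

lemma balance:
  assumes \<sigma>: "\<sigma> \<in> stopping_times P F T" and t: "t \<in> {0..T}"
    and t_le: "\<And>\<omega>. \<omega> \<in> space P \<Longrightarrow> t \<le> \<sigma> \<omega>" and B: "B \<in> sets (F t)"
  shows "(LINT \<omega>:B|P. Y t \<omega>) = (LINT \<omega>:B|P. Y (\<sigma> \<omega>) \<omega>) + (LINT \<omega>:B|P. I (\<sigma> \<omega>) \<omega> - I t \<omega>)"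
proof -
  obtain H where H: "integrable P H"
      "\<And>\<sigma>. \<sigma> \<in> stopping_times P F T \<Longrightarrow> AE \<omega> in P. \<bar>Y (\<sigma> \<omega>) \<omega>\<bar> \<le> H \<omega>"
    using Y_dominated by auto
  have BP: "B \<in> sets P" using B t sets_F_imp_sets by blast
  note int = stopped_Y_integrable[OF \<sigma>] stopped_penalty_integrable[OF \<sigma>]
    stopped_Y_integrable[OF const_stopping_times[OF t]]
    stopped_penalty_integrable[OF const_stopping_times[OF t]]
  note set_int = int[THEN set_integrable_sets, OF BP]
  have "(LINT \<omega>:B|P. Y (\<sigma> \<omega>) \<omega> + I (\<sigma> \<omega>) \<omega>) = (LINT \<omega>:B|P. Y t \<omega> + I t \<omega>)"
  proof (rule optional_stopping[where H = "\<lambda>\<omega>. H \<omega> + I T \<omega>", OF _ _ _ _ _ \<sigma> t t_le B])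
    show "adapted F T (\<lambda>t \<omega>. Y t \<omega> + I t \<omega>)"
      using Y_adapted penalty_adapted by (auto simp: adapted_def intro!: borel_measurable_add)
    show "AE \<omega> in P. right_cont_path T (\<lambda>t. Y t \<omega> + I t \<omega>)"
      using Y_right_cont penalty_right_cont
      by eventually_elim (auto simp: right_cont_path_def intro: tendsto_add)
    show "integrable P (\<lambda>\<omega>. H \<omega> + I T \<omega>)" using H(1) penalty_integrable by simp
    show "AE \<omega> in P. \<bar>Y (\<sigma> \<omega>) \<omega> + I (\<sigma> \<omega>) \<omega>\<bar> \<le> H \<omega> + I T \<omega>"
      if \<sigma>: "\<sigma> \<in> stopping_times P F T" for \<sigma>
      using H(2)[OF \<sigma>] penalty_stopped_bound[OF \<sigma>] by eventually_elim auto
  qed (rule balance_T)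
  then show ?thesis using set_int by simp
qed

text \<open>
  The penalty never decreases, so \<open>Y\<close> is a supermartingale.
\<close>

lemma stopped_Y_le:
  assumes \<sigma>: "\<sigma> \<in> stopping_times P F T" and t: "t \<in> {0..T}"
    and t_le: "\<And>\<omega>. \<omega> \<in> space P \<Longrightarrow> t \<le> \<sigma> \<omega>" and B: "B \<in> sets (F t)"
  shows "(LINT \<omega>:B|P. Y (\<sigma> \<omega>) \<omega>) \<le> (LINT \<omega>:B|P. Y t \<omega>)"
proof -
  have "AE \<omega> in P. 0 \<le> I (\<sigma> \<omega>) \<omega> - I t \<omega>"
    using penalty_mono AE_space
  proof eventually_elim
    case (elim \<omega>)
    then show ?case using stopping_times_bounds[OF \<sigma> elim(2)] t_le[OF elim(2)] t by auto
  qed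
  then have "0 \<le> (LINT \<omega>:B|P. I (\<sigma> \<omega>) \<omega> - I t \<omega>)"
    unfolding set_lebesgue_integral_def
    by (intro integral_nonneg_AE) (auto elim!: eventually_mono)
  then show ?thesis using balance[OF assms] by simp
qed

text \<open>
  The stopping time is the moment \<open>\<sigma>\<close> at which the penalty starts to increase after \<open>t\<close>. Up to \<open>\<sigma>\<close> nothing
  is added, so \<open>Y\<close> is a martingale there; just after \<open>\<sigma> < T\<close> the penalty integral over every short interval is
  positive, which forces the clock to run and the solution to be below the obstacle somewhere in the interval.
\<close>

lemma le_cond_exp_payoff:
  assumes t: "t \<in> {0..T}"
  shows "\<exists>\<sigma>\<in>support_stopping_times_from P F T A t.
    AE \<omega> in P. Y t \<omega> \<le> real_cond_exp P (F t) (payoff \<sigma>) \<omega>"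
proof -
  \<comment> \<open>The minimum makes the increment after \<open>t\<close> an adapted process that vanishes up to \<open>t\<close>.\<close>
  define J where "J s \<omega> = I s \<omega> - I (min s t) \<omega>" for s \<omega>
  define \<sigma> where "\<sigma> \<omega> = passage_time T t (\<lambda>s. J s \<omega>) 0" for \<omega>
  have J_adapted: "adapted F T J"
    unfolding adapted_def J_def
  proof
    fix s assume s: "s \<in> {0..T}"
    have "I (min s t) \<in> borel_measurable (F (min s t))"
      using penalty_adapted s t by (auto simp: adapted_def)
    then have "I (min s t) \<in> borel_measurable (F s)"
      by (rule measurable_F_mono[rotated]) simp
    then show "(\<lambda>\<omega>. I s \<omega> - I (min s t) \<omega>) \<in> borel_measurable (F s)"
      using penalty_adapted s by (auto simp: adapted_def intro!: borel_measurable_diff)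
  qed
  have \<sigma>: "\<sigma> \<in> stopping_times P F T"
    unfolding \<sigma>_def by (rule passage_time_stopping_times[OF const_stopping_times[OF t] J_adapted])
  have bounds: "t \<le> \<sigma> \<omega>" "\<sigma> \<omega> \<le> T" for \<omega>
    using t by (auto simp: \<sigma>_def intro: passage_time_le passage_time_ge)
  have frozen: "AE \<omega> in P. I (\<sigma> \<omega>) \<omega> = I t \<omega>"
    using penalty_mono penalty_continuous
  proof eventually_elim
    case (elim \<omega>)
    have le: "I s \<omega> \<le> I t \<omega>" if s: "t \<le> s" "s < \<sigma> \<omega>" for s
    proof -
      have "right_cont_path T (\<lambda>s. J s \<omega>)"
      proof (rule continuous_on_imp_right_cont_path)
        show "continuous_on {0..T} (\<lambda>s. J s \<omega>)"
          unfolding J_def using t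
          by (intro continuous_intros elim(2) continuous_on_compose2[OF elim(2), of _ "\<lambda>s. min s t"]) auto
      qed
      then have "J s \<omega> \<le> 0"
        using s t by (intro passage_time_before[of T "\<lambda>s. J s \<omega>" s t]) (auto simp: \<sigma>_def)
      then show ?thesis using s by (simp add: J_def min_absorb2)
    qed
    have "I (\<sigma> \<omega>) \<omega> \<le> I t \<omega>"
    proof (cases "\<sigma> \<omega> = t")
      case False
      then have less: "t < \<sigma> \<omega>" using bounds(1)[of \<omega>] by simp
      have "continuous_on {t..\<sigma> \<omega>} (\<lambda>s. I s \<omega>)"
        using bounds[of \<omega>] t by (intro continuous_on_subset[OF elim(2)]) auto
      then have "((\<lambda>s. I s \<omega>) \<longlongrightarrow> I (\<sigma> \<omega>) \<omega>) (at (\<sigma> \<omega>) within {t..\<sigma> \<omega>})"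
        using less by (auto simp: continuous_on_def)
      then have "((\<lambda>s. I s \<omega>) \<longlongrightarrow> I (\<sigma> \<omega>) \<omega>) (at_left (\<sigma> \<omega>))"
        by (simp add: at_within_Icc_at_left[OF less])
      moreover have "eventually (\<lambda>s. I s \<omega> \<le> I t \<omega>) (at_left (\<sigma> \<omega>))"
        using eventually_at_left_real[OF less] by eventually_elim (auto intro: le)
      ultimately show ?thesis by (rule tendsto_upperbound) (simp add: trivial_limit_at_left_real)
    qed simp
    moreover have "I t \<omega> \<le> I (\<sigma> \<omega>) \<omega>" using elim(1) bounds[of \<omega>] t by auto
    ultimately show ?case by simp
  qed
  have after: "AE \<omega> in P. \<sigma> \<omega> < T \<longrightarrow> \<sigma> \<omega> \<in> right_support T (\<lambda>t. A t \<omega>) \<and> Y (\<sigma> \<omega>) \<omega> \<le> \<eta> (\<sigma> \<omega>) \<omega>"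
    using frozen penalty_increment penalty_integrand clock_path Y_right_cont \<eta>_right_cont
  proof eventually_elim
    case (elim \<omega>)
    have path: "mono_on {0..T} (\<lambda>t. A t \<omega>)" "continuous_on {0..T} (\<lambda>t. A t \<omega>)"
      using elim(4) by auto
    have \<sigma>0: "0 \<le> \<sigma> \<omega>" using bounds(1)[of \<omega>] t by auto
    have ex: "A (\<sigma> \<omega>) \<omega> < A b \<omega> \<and> (\<exists>u. \<sigma> \<omega> < u \<and> u < b \<and> Y u \<omega> < \<eta> u \<omega>)"
      if b: "\<sigma> \<omega> < b" "b \<le> T" for b
    proof -
      obtain q where q: "q \<in> \<rat>" "t \<le> q" "q < b" "0 < J q \<omega>"
        using b passage_time_less_iff[of b T t "\<lambda>s. J s \<omega>" 0] unfolding \<sigma>_def by auto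
      have Iq: "I (\<sigma> \<omega>) \<omega> < I q \<omega>" using q elim(1) by (simp add: J_def min_def split: if_splits)
      have "\<sigma> \<omega> \<le> q" unfolding \<sigma>_def using q b by (intro passage_time_least) auto
      then have \<sigma>q: "\<sigma> \<omega> < q" using Iq by (cases "\<sigma> \<omega> = q") auto
      have qT: "q \<le> T" using q b by simp
      have "I q \<omega> - I (\<sigma> \<omega>) \<omega> =
          (LINT u:{\<sigma> \<omega><..q}|path_measure T A \<omega>. real n * max 0 (\<eta> u \<omega> - Y u \<omega>))"
        by (rule elim(2)[rule_format, OF \<sigma>0 less_imp_le[OF \<sigma>q] qT])
      then have pos: "0 < (LINT u:{\<sigma> \<omega><..q}|path_measure T A \<omega>. real n * max 0 (\<eta> u \<omega> - Y u \<omega>))"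
        using Iq by linarith
      note imp = path_integral_pos_imp[OF T_pos path elim(3) \<sigma>0 less_imp_le[OF \<sigma>q] _ pos]
      obtain u where u: "\<sigma> \<omega> < u" "u \<le> q" "0 < real n * max 0 (\<eta> u \<omega> - Y u \<omega>)"
        using imp(2)[OF qT] by auto
      then have "Y u \<omega> < \<eta> u \<omega>" by (auto simp: max_def zero_less_mult_iff split: if_splits)
      moreover have "A q \<omega> \<le> A b \<omega>"
        using path(1) \<sigma>0 \<sigma>q q b by (auto simp: mono_on_def)
      ultimately show ?thesis using imp(1)[OF qT] u q by force
    qed
    show ?case
    proof (intro impI conjI)
      assume less: "\<sigma> \<omega> < T"
      show "\<sigma> \<omega> \<in> right_support T (\<lambda>t. A t \<omega>)"
        unfolding right_support_def
      proof (intro CollectI conjI allI impI \<sigma>0)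
        fix e :: real assume "0 < e"
        then show "0 < A (min (\<sigma> \<omega> + e) T) \<omega> - A (min (\<sigma> \<omega>) T) \<omega>"
          using ex[of "min (\<sigma> \<omega> + e) T"] less by (simp add: min_absorb1)
      qed
      show "Y (\<sigma> \<omega>) \<omega> \<le> \<eta> (\<sigma> \<omega>) \<omega>"
      proof (rule ccontr)
        assume "\<not> ?thesis"
        moreover have "((\<lambda>s. Y s \<omega> - \<eta> s \<omega>) \<longlongrightarrow> Y (\<sigma> \<omega>) \<omega> - \<eta> (\<sigma> \<omega>) \<omega>) (at_right (\<sigma> \<omega>))"
          using elim(5,6) \<sigma>0 less by (intro tendsto_diff) (auto simp: right_cont_path_def)
        ultimately have "eventually (\<lambda>s. 0 < Y s \<omega> - \<eta> s \<omega>) (at_right (\<sigma> \<omega>))"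
          by (intro order_tendstoD) auto
        then obtain b where b: "\<sigma> \<omega> < b" "\<And>u. \<sigma> \<omega> < u \<Longrightarrow> u < b \<Longrightarrow> 0 < Y u \<omega> - \<eta> u \<omega>"
          by (auto simp: eventually_at_right_field)
        obtain u where "\<sigma> \<omega> < u" "u < min b T" "Y u \<omega> < \<eta> u \<omega>"
          using ex[of "min b T"] b(1) less by auto
        then show False using b(2)[of u] by simp
      qed
    qed
  qed
  have support: "\<sigma> \<in> support_stopping_times_from P F T A t"
  proof -
    have "AE \<omega> in P. \<sigma> \<omega> \<in> support_bar T A \<omega> \<and> \<sigma> \<omega> \<in> {t..T}"
      using after
    proof eventually_elim
      case (elim \<omega>)
      then show ?case using bounds[of \<omega>] by (cases "\<sigma> \<omega> = T") (auto simp: support_bar_def)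
    qed
    then show ?thesis
      using \<sigma> by (auto simp: support_stopping_times_from_def support_stopping_times_def
          elim: eventually_mono)
  qed
  have le_payoff: "AE \<omega> in P. Y (\<sigma> \<omega>) \<omega> \<le> payoff \<sigma> \<omega>"
    using after Y_terminal
  proof eventually_elim
    case (elim \<omega>)
    then show ?case
      using bounds(2)[of \<omega>] by (cases "\<sigma> \<omega> = T") (auto simp: payoff_def indicator_def)
  qed
  have "AE \<omega> in P. Y t \<omega> \<le> real_cond_exp P (F t) (payoff \<sigma>) \<omega>"
  proof (rule le_real_cond_expI[OF t])
    show "integrable P (Y t)" by (rule stopped_Y_integrable[OF const_stopping_times[OF t]])
    show "Y t \<in> borel_measurable (F t)" using Y_adapted t by (auto simp: adapted_def)
    show "integrable P (payoff \<sigma>)" by (rule payoff_integrable[OF \<sigma>])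
    fix B assume B: "B \<in> sets (F t)"
    then have BP: "B \<in> sets P" using t sets_F_imp_sets by blast
    have "(LINT \<omega>:B|P. I (\<sigma> \<omega>) \<omega> - I t \<omega>) = (LINT \<omega>:B|P. 0)"
    proof (rule set_lebesgue_integral_cong_AE[OF BP])
      show "(\<lambda>\<omega>. I (\<sigma> \<omega>) \<omega> - I t \<omega>) \<in> borel_measurable P"
        using stopped_penalty_integrable[OF \<sigma>]
          stopped_penalty_integrable[OF const_stopping_times[OF t]] by simp
      show "AE \<omega>\<in>B in P. I (\<sigma> \<omega>) \<omega> - I t \<omega> = 0" using frozen by eventually_elim simp
    qed simp
    then have "(LINT \<omega>:B|P. Y t \<omega>) = (LINT \<omega>:B|P. Y (\<sigma> \<omega>) \<omega>)"
      using balance[OF \<sigma> t bounds(1) B] by simp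
    also have "\<dots> \<le> (LINT \<omega>:B|P. payoff \<sigma> \<omega>)"
      using le_payoff
      by (intro set_integral_mono_AE set_integrable_sets BP stopped_Y_integrable \<sigma> payoff_integrable)
         (auto elim: eventually_mono)
    finally show "(LINT \<omega>:B|P. Y t \<omega>) \<le> (LINT \<omega>:B|P. payoff \<sigma> \<omega>)" .
  qed
  with support show ?thesis by blast
qed

lemma Y_upper: "AE \<omega> in P. \<forall>t\<in>{0..T}. Y t \<omega> \<le> K"
proof (rule AE_all_times_le[OF Y_right_cont])
  fix t assume t: "t \<in> {0..T}"
  interpret E: sigma_finite_subalgebra P "F t" by (rule sigma_finite_subalgebra_F[OF t])
  obtain \<sigma> where \<sigma>: "\<sigma> \<in> stopping_times P F T"
      and le: "AE \<omega> in P. Y t \<omega> \<le> real_cond_exp P (F t) (payoff \<sigma>) \<omega>"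
    using le_cond_exp_payoff[OF t] support_stopping_times_from_imp_stopping_times by blast
  have "AE \<omega> in P. real_cond_exp P (F t) (payoff \<sigma>) \<omega> \<le> K"
    using payoff_bound[OF \<sigma>]
    by (intro E.real_cond_exp_le_c payoff_integrable \<sigma>) (auto elim: eventually_mono)
  with le show "AE \<omega> in P. Y t \<omega> \<le> K" by eventually_elim simp
qed

text \<open>
  By the supermartingale property \<open>Y\<close> dominates the conditional expectation of \<open>\<xi>\<close>.
\<close>

lemma Y_lower: "AE \<omega> in P. \<forall>t\<in>{0..T}. - K \<le> Y t \<omega>"
proof -
  have "AE \<omega> in P. \<forall>t\<in>{0..T}. - Y t \<omega> \<le> K"
  proof (rule AE_all_times_le)
    show "AE \<omega> in P. right_cont_path T (\<lambda>t. - Y t \<omega>)"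
      using Y_right_cont by eventually_elim (auto simp: right_cont_path_def intro: tendsto_minus)
    fix t assume t: "t \<in> {0..T}"
    have T: "(\<lambda>_. T) \<in> stopping_times P F T" using T_pos by (intro const_stopping_times) auto
    have "AE \<omega> in P. - K \<le> Y t \<omega>"
    proof (rule AE_le_of_set_integrals_le[OF t])
      show "integrable P (Y t)" by (rule stopped_Y_integrable[OF const_stopping_times[OF t]])
      show "Y t \<in> borel_measurable (F t)" using Y_adapted t by (auto simp: adapted_def)
      fix B assume B: "B \<in> sets (F t)"
      then have BP: "B \<in> sets P" using t sets_F_imp_sets by blast
      have "(LINT \<omega>:B|P. - K) \<le> (LINT \<omega>:B|P. Y T \<omega>)"
      proof (intro set_integral_mono_AE set_integrable_sets BP)
        show "integrable P (Y T)" by (rule stopped_Y_integrable[OF T])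
        show "AE \<omega>\<in>B in P. - K \<le> Y T \<omega>"
          using Y_terminal \<xi>_bound by eventually_elim auto
      qed simp
      also have "\<dots> \<le> (LINT \<omega>:B|P. Y t \<omega>)"
        using t by (intro stopped_Y_le[OF T t _ B]) auto
      finally show "(LINT \<omega>:B|P. - K) \<le> (LINT \<omega>:B|P. Y t \<omega>)" .
    qed simp_all
    then show "AE \<omega> in P. - Y t \<omega> \<le> K" by eventually_elim simp
  qed
  then show ?thesis by eventually_elim (simp add: minus_le_iff)
qed

text \<open>
  The total penalty is paid for by the change of \<open>Y\<close> between \<open>0\<close> and \<open>T\<close>; the bound is uniform in \<open>n\<close>.
\<close>

lemma expected_penalty: "(LINT \<omega>|P. I T \<omega>) \<le> 2 * K"
proof -
  have 0: "0 \<in> {0..T}" and T: "T \<in> {0..T}" using T_pos by auto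
  have sp: "space P \<in> sets (F 0)" by (metis sets.top space_F)
  note int = stopped_Y_integrable[OF const_stopping_times[OF 0]]
    stopped_Y_integrable[OF const_stopping_times[OF T]]
  have "(LINT \<omega>:space P|P. Y 0 \<omega> + I 0 \<omega>) = (LINT \<omega>:space P|P. Y T \<omega> + I T \<omega>)"
    by (rule balance_T[OF 0 sp])
  then have "(LINT \<omega>|P. Y 0 \<omega>) = (LINT \<omega>|P. Y T \<omega>) + (LINT \<omega>|P. I T \<omega>)"
    using int penalty_integrable by (simp add: set_integral_space penalty_0)
  moreover have "(LINT \<omega>|P. Y 0 \<omega>) \<le> K"
    using Y_upper 0 by (intro integral_le_const int) (auto elim!: eventually_mono)
  moreover have "- K \<le> (LINT \<omega>|P. Y T \<omega>)"
    using Y_lower T by (intro integral_ge_const int) (auto elim!: eventually_mono)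
  ultimately show ?thesis by simp
qed

end

section \<open>Comparison and monotone convergence of the solutions\<close>

context penalization
begin

text \<open>
  With \<open>N\<close> the stochastic integral, the equation reads \<open>Y t + I t = N t + (\<xi> - N T + I T)\<close>, and the last
  bracket does not depend on \<open>t\<close>. At \<open>t = 0\<close> it expresses \<open>I T\<close> through integrable variables. The
  domination comes from the essential supremum in the norm of \<open>S2_space\<close>.
\<close>

lemma gbsde_solution_imp_penalized_solution:
  assumes S2: "Y \<in> S2_space P F T"
    and sol: "gbsde_solution P F T M A \<xi> (\<lambda>t \<omega> y. real n * max 0 (\<eta> t \<omega> - y)) Y Z"
  shows "penalized_solution P F T A \<xi> \<eta> K n Y"
proof -
  have I_eq: "(\<lambda>t \<omega>. LINT s:{0<..t}|path_measure T A \<omega>. real n * max 0 (\<eta> s \<omega> - Y s \<omega>)) = penalty n Y"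
    by (intro ext) (simp add: penalty_def)
  have Y_adapted: "adapted F T Y" and I_adapted: "adapted F T (penalty n Y)"
    and integrand: "AE \<omega> in P. set_integrable (path_measure T A \<omega>) {0<..T}
      (\<lambda>s. real n * max 0 (\<eta> s \<omega> - Y s \<omega>))"
    using sol unfolding gbsde_solution_def I_eq by auto
  obtain N where N: "martingale P F T N" and eq: "AE \<omega> in P. \<forall>t\<in>{0..T}. Y t \<omega> = \<xi> \<omega> - (N T \<omega> - N t \<omega>)
      + (LINT s:{t<..T}|path_measure T A \<omega>. real n * max 0 (\<eta> s \<omega> - Y s \<omega>))"
    using sol unfolding gbsde_solution_def by blast
  have T: "T \<in> {0..T}" and 0: "0 \<in> {0..T}" using T_pos by auto
  have terminal: "AE \<omega> in P. Y T \<omega> = \<xi> \<omega>"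
    using eq
  proof eventually_elim
    case (elim \<omega>)
    have "Y T \<omega> = \<xi> \<omega> - (N T \<omega> - N T \<omega>)
        + (LINT s:{T<..T}|path_measure T A \<omega>. real n * max 0 (\<eta> s \<omega> - Y s \<omega>))"
      using elim T by blast
    then show ?case by (simp add: set_lebesgue_integral_def)
  qed
  have dominated: "\<exists>H. integrable P H \<and> (\<forall>\<sigma>\<in>stopping_times P F T. AE \<omega> in P. \<bar>Y (\<sigma> \<omega>) \<omega>\<bar> \<le> H \<omega>)"
  proof -
    obtain G where G: "is_ess_sup P {\<lambda>\<omega>. ennreal (\<bar>Y (\<tau> \<omega>) \<omega>\<bar>\<^sup>2) |\<tau>. \<tau> \<in> stopping_times P F T} G"
        "(\<integral>\<^sup>+\<omega>. G \<omega> \<partial>P) < \<infinity>"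
      using S2 by (auto simp: S2_space_def)
    have meas: "G \<in> borel_measurable P" using G(1) by (simp add: is_ess_sup_def)
    have fin: "AE \<omega> in P. G \<omega> \<noteq> \<infinity>"
      using G(2) by (intro nn_integral_noteq_infinite meas) auto
    have "(\<integral>\<^sup>+\<omega>. ennreal (enn2real (G \<omega>)) \<partial>P) = (\<integral>\<^sup>+\<omega>. G \<omega> \<partial>P)"
      using fin by (intro nn_integral_cong_AE) (auto elim!: eventually_mono simp: top.not_eq_extremum)
    then have "integrable P (\<lambda>\<omega>. enn2real (G \<omega>))"
      using G(2) meas by (intro integrableI_nonneg) auto
    then have "integrable P (\<lambda>\<omega>. 1 + enn2real (G \<omega>))" by simp
    moreover have "AE \<omega> in P. \<bar>Y (\<sigma> \<omega>) \<omega>\<bar> \<le> 1 + enn2real (G \<omega>)"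
      if \<sigma>: "\<sigma> \<in> stopping_times P F T" for \<sigma>
    proof -
      have "AE \<omega> in P. ennreal (\<bar>Y (\<sigma> \<omega>) \<omega>\<bar>\<^sup>2) \<le> G \<omega>"
        using G(1) \<sigma> by (auto simp: is_ess_sup_def)
      with fin show ?thesis
      proof eventually_elim
        case (elim \<omega>)
        have "\<bar>Y (\<sigma> \<omega>) \<omega>\<bar>\<^sup>2 \<le> enn2real (G \<omega>)"
          using enn2real_mono[OF elim(2)] elim(1) by (simp add: top.not_eq_extremum)
        moreover have "0 \<le> (\<bar>Y (\<sigma> \<omega>) \<omega>\<bar> - 1)\<^sup>2" by simp
        then have "2 * \<bar>Y (\<sigma> \<omega>) \<omega>\<bar> \<le> 1 + \<bar>Y (\<sigma> \<omega>) \<omega>\<bar>\<^sup>2" by (simp add: power2_diff)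
        ultimately show ?case by linarith
      qed
    qed
    ultimately show ?thesis by blast
  qed
  have Y_integrable: "integrable P (Y t)" if t: "t \<in> {0..T}" for t
  proof -
    obtain H where H: "integrable P H"
        "\<forall>\<sigma>\<in>stopping_times P F T. AE \<omega> in P. \<bar>Y (\<sigma> \<omega>) \<omega>\<bar> \<le> H \<omega>"
      using dominated by auto
    show ?thesis
    proof (rule Bochner_Integration.integrable_bound[OF H(1) adapted_imp_measurable[OF Y_adapted t]])
      show "AE \<omega> in P. norm (Y t \<omega>) \<le> norm (H \<omega>)"
        using bspec[OF H(2) const_stopping_times[OF t]] by eventually_elim auto
    qed
  qed
  have N_integrable: "integrable P (N t)" if "t \<in> {0..T}" for t
    using N that by (auto simp: martingale_def)
  have \<xi>_integrable: "integrable P \<xi>"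
    using \<xi>_bound measurable_F_imp_measurable[OF T \<xi>_measurable]
    by (intro integrable_const_bound[of _ K]) auto
  have I_integrable: "integrable P (penalty n Y T)"
  proof (subst integrable_cong_AE)
    show "AE \<omega> in P. penalty n Y T \<omega> = Y 0 \<omega> - \<xi> \<omega> + (N T \<omega> - N 0 \<omega>)"
      using eq by eventually_elim (use 0 in \<open>simp add: penalty_def\<close>)
    show "integrable P (\<lambda>\<omega>. Y 0 \<omega> - \<xi> \<omega> + (N T \<omega> - N 0 \<omega>))"
      using Y_integrable N_integrable \<xi>_integrable T 0 by simp
    show "penalty n Y T \<in> borel_measurable P" by (rule adapted_imp_measurable[OF I_adapted T])
    show "(\<lambda>\<omega>. Y 0 \<omega> - \<xi> \<omega> + (N T \<omega> - N 0 \<omega>)) \<in> borel_measurable P"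
      using Y_integrable N_integrable \<xi>_integrable T 0 by simp
  qed
  define R where "R \<omega> = \<xi> \<omega> - N T \<omega> + penalty n Y T \<omega>" for \<omega>
  have R_integrable: "integrable P R"
    unfolding R_def using \<xi>_integrable N_integrable[OF T] I_integrable by simp
  have decomposition: "AE \<omega> in P. Y t \<omega> + penalty n Y t \<omega> = N t \<omega> + R \<omega>" if t: "t \<in> {0..T}" for t
    using eq clock_path integrand
  proof eventually_elim
    case (elim \<omega>)
    have "penalty n Y T \<omega> - penalty n Y t \<omega> =
        (LINT s:{t<..T}|path_measure T A \<omega>. real n * max 0 (\<eta> s \<omega> - Y s \<omega>))"
      unfolding penalty_def using elim(2) t
      by (intro path_integral_increment[OF T_pos _ _ elim(3)]) auto
    then show ?case using elim(1) t by (simp add: R_def)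
  qed
  have balance: "(LINT \<omega>:B|P. Y t \<omega> + penalty n Y t \<omega>) = (LINT \<omega>:B|P. Y T \<omega> + penalty n Y T \<omega>)"
    if t: "t \<in> {0..T}" and B: "B \<in> sets (F t)" for t B
  proof -
    interpret E: sigma_finite_subalgebra P "F t" by (rule sigma_finite_subalgebra_F[OF t])
    have BP: "B \<in> sets P" using B t sets_F_imp_sets by blast
    have split: "(LINT \<omega>:B|P. Y s \<omega> + penalty n Y s \<omega>) = (LINT \<omega>:B|P. N s \<omega>) + (LINT \<omega>:B|P. R \<omega>)"
      if s: "s \<in> {0..T}" for s
    proof -
      have "(LINT \<omega>:B|P. Y s \<omega> + penalty n Y s \<omega>) = (LINT \<omega>:B|P. N s \<omega> + R \<omega>)"
      proof (rule set_lebesgue_integral_cong_AE[OF BP])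
        show "(\<lambda>\<omega>. Y s \<omega> + penalty n Y s \<omega>) \<in> borel_measurable P"
          using adapted_imp_measurable[OF Y_adapted s] adapted_imp_measurable[OF I_adapted s]
          by (rule borel_measurable_add)
        show "(\<lambda>\<omega>. N s \<omega> + R \<omega>) \<in> borel_measurable P"
          using N_integrable[OF s] R_integrable by simp
        show "AE \<omega>\<in>B in P. Y s \<omega> + penalty n Y s \<omega> = N s \<omega> + R \<omega>"
          using decomposition[OF s] by eventually_elim simp
      qed
      then show ?thesis
        using set_integrable_sets[OF N_integrable[OF s] BP] set_integrable_sets[OF R_integrable BP]
        by simp
    qed
    have "(LINT \<omega>:B|P. N T \<omega>) = (LINT \<omega>:B|P. real_cond_exp P (F t) (N T) \<omega>)"
      by (rule E.real_cond_exp_intA[OF N_integrable[OF T] B])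
    also have "\<dots> = (LINT \<omega>:B|P. N t \<omega>)"
    proof (rule set_lebesgue_integral_cong_AE[OF BP])
      have "AE \<omega> in P. real_cond_exp P (F t) (N T) \<omega> = N t \<omega>"
        using N t by (auto simp: martingale_def)
      then show "AE \<omega>\<in>B in P. real_cond_exp P (F t) (N T) \<omega> = N t \<omega>"
        by eventually_elim simp
    qed (use N_integrable[OF t] E.real_cond_exp_int(1)[OF N_integrable[OF T]] in auto)
    finally show ?thesis using split[OF t] split[OF T] by simp
  qed
  show ?thesis
  proof unfold_locales
    show "AE \<omega> in P. right_cont_path T (\<lambda>t. Y t \<omega>)"
      using sol by (auto simp: gbsde_solution_def cadlag_path_def elim: eventually_mono)
    show "AE \<omega> in P. continuous_on {0..T} (\<lambda>t. penalty n Y t \<omega>)"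
      using sol unfolding gbsde_solution_def penalty_def by (auto elim: eventually_mono)
  qed (fact Y_adapted terminal dominated I_adapted integrand I_integrable | rule balance, assumption+)+
qed

text \<open>
  A passage time settles the comparison, because the generator decreases in \<open>y\<close>: as long as \<open>Y\<close> exceeds
  \<open>Y'\<close> by at least \<open>\<delta>\<close>, the penalty of \<open>Y\<close> grows no faster than that of \<open>Y'\<close>, and at the end \<open>\<sigma>\<close> of this period the excess is at most \<open>\<delta>\<close>.
\<close>

lemma penalized_solution_mono:
  assumes "penalized_solution P F T A \<xi> \<eta> K n Y" and "penalized_solution P F T A \<xi> \<eta> K m Y'"
    and nm: "n \<le> m"
  shows "AE \<omega> in P. \<forall>t\<in>{0..T}. Y t \<omega> \<le> Y' t \<omega>"
proof -
  interpret S: penalized_solution P F T A \<xi> \<eta> K n Y by fact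
  interpret S': penalized_solution P F T A \<xi> \<eta> K m Y' by fact
  have "AE \<omega> in P. \<forall>t\<in>{0..T}. Y t \<omega> - Y' t \<omega> \<le> 0"
  proof (rule AE_all_times_le)
    show "AE \<omega> in P. right_cont_path T (\<lambda>t. Y t \<omega> - Y' t \<omega>)"
      using S.Y_right_cont S'.Y_right_cont
      by eventually_elim (auto simp: right_cont_path_def intro: tendsto_diff)
    fix t assume t: "t \<in> {0..T}"
    note ct = const_stopping_times[OF t]
    have le_\<delta>: "AE \<omega> in P. Y t \<omega> - Y' t \<omega> \<le> \<delta>" if \<delta>: "0 < \<delta>" for \<delta> :: real
    proof -
      define \<sigma> where "\<sigma> \<omega> = passage_time T t (\<lambda>s. Y' s \<omega> - Y s \<omega>) (- \<delta>)" for \<omega>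
      have "adapted F T (\<lambda>s \<omega>. Y' s \<omega> - Y s \<omega>)"
        using S.Y_adapted S'.Y_adapted by (auto simp: adapted_def intro!: borel_measurable_diff)
      then have \<sigma>: "\<sigma> \<in> stopping_times P F T"
        unfolding \<sigma>_def by (rule passage_time_stopping_times[OF ct])
      have bounds: "t \<le> \<sigma> \<omega>" "\<sigma> \<omega> \<le> T" for \<omega>
        using t by (auto simp: \<sigma>_def intro: passage_time_le passage_time_ge)
      have path: "AE \<omega> in P. Y (\<sigma> \<omega>) \<omega> - Y' (\<sigma> \<omega>) \<omega> \<le> \<delta> \<and>
          S.I (\<sigma> \<omega>) \<omega> - S.I t \<omega> \<le> S'.I (\<sigma> \<omega>) \<omega> - S'.I t \<omega>"
        using S.Y_right_cont S'.Y_right_cont S.Y_terminal S'.Y_terminal clock_path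
          S.penalty_integrand S'.penalty_integrand S.penalty_increment S'.penalty_increment
      proof eventually_elim
        case (elim \<omega>)
        have rc: "right_cont_path T (\<lambda>s. Y' s \<omega> - Y s \<omega>)"
          using elim(1,2) by (auto simp: right_cont_path_def intro: tendsto_diff)
        have "Y (\<sigma> \<omega>) \<omega> - Y' (\<sigma> \<omega>) \<omega> \<le> \<delta>"
        proof (cases "\<sigma> \<omega> < T")
          case True
          then have "- \<delta> \<le> Y' (\<sigma> \<omega>) \<omega> - Y (\<sigma> \<omega>) \<omega>"
            using passage_time_at[OF rc, of t "- \<delta>"] t by (simp add: \<sigma>_def)
          then show ?thesis by simp
        next
          case False
          then have "\<sigma> \<omega> = T" using bounds(2)[of \<omega>] by simp
          then show ?thesis using elim(3,4) \<delta> by simp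
        qed
        moreover have "S.I (\<sigma> \<omega>) \<omega> - S.I t \<omega> \<le> S'.I (\<sigma> \<omega>) \<omega> - S'.I t \<omega>"
        proof -
          have "real n * max 0 (\<eta> u \<omega> - Y u \<omega>) \<le> real m * max 0 (\<eta> u \<omega> - Y' u \<omega>)"
            if u: "t < u" "u < \<sigma> \<omega>" for u
          proof -
            have "Y' u \<omega> - Y u \<omega> \<le> - \<delta>"
              using u t by (intro passage_time_before[OF rc, of u t]) (auto simp: \<sigma>_def)
            then show ?thesis using nm \<delta> by (intro mult_mono) auto
          qed
          then have "(LINT u:{t<..\<sigma> \<omega>}|path_measure T A \<omega>. real n * max 0 (\<eta> u \<omega> - Y u \<omega>)) \<le>
              (LINT u:{t<..\<sigma> \<omega>}|path_measure T A \<omega>. real m * max 0 (\<eta> u \<omega> - Y' u \<omega>))"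
            using t bounds[of \<omega>] elim(5)
            by (intro path_integral_mono[OF T_pos _ _ elim(6,7)]) auto
          then show ?thesis using elim(8,9) t bounds[of \<omega>] by auto
        qed
        ultimately show ?case by simp
      qed
      show ?thesis
      proof (rule AE_le_of_set_integrals_le[OF t])
        show "integrable P (\<lambda>\<omega>. Y t \<omega> - Y' t \<omega>)"
          using S.stopped_Y_integrable[OF ct] S'.stopped_Y_integrable[OF ct] by simp
        show "(\<lambda>\<omega>. Y t \<omega> - Y' t \<omega>) \<in> borel_measurable (F t)"
          using S.Y_adapted S'.Y_adapted t by (auto simp: adapted_def intro!: borel_measurable_diff)
        fix B assume B: "B \<in> sets (F t)"
        then have BP: "B \<in> sets P" using t sets_F_imp_sets by blast
        note si = set_integrable_sets[OF _ BP]
        note int = S.stopped_Y_integrable[OF ct, THEN si] S'.stopped_Y_integrable[OF ct, THEN si]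
          S.stopped_Y_integrable[OF \<sigma>, THEN si] S'.stopped_Y_integrable[OF \<sigma>, THEN si]
          S.stopped_penalty_integrable[OF ct, THEN si] S'.stopped_penalty_integrable[OF ct, THEN si]
          S.stopped_penalty_integrable[OF \<sigma>, THEN si] S'.stopped_penalty_integrable[OF \<sigma>, THEN si]
        have "(LINT \<omega>:B|P. Y t \<omega> - Y' t \<omega>) =
            (LINT \<omega>:B|P. (Y (\<sigma> \<omega>) \<omega> - Y' (\<sigma> \<omega>) \<omega>) +
              ((S.I (\<sigma> \<omega>) \<omega> - S.I t \<omega>) - (S'.I (\<sigma> \<omega>) \<omega> - S'.I t \<omega>)))"
          using S.balance[OF \<sigma> t bounds(1) B] S'.balance[OF \<sigma> t bounds(1) B] int by simp
        also have "\<dots> \<le> (LINT \<omega>:B|P. \<delta>)"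
        proof (rule set_integral_mono_AE)
          show "AE \<omega>\<in>B in P. Y (\<sigma> \<omega>) \<omega> - Y' (\<sigma> \<omega>) \<omega> +
              (S.I (\<sigma> \<omega>) \<omega> - S.I t \<omega> - (S'.I (\<sigma> \<omega>) \<omega> - S'.I t \<omega>)) \<le> \<delta>"
            using path by eventually_elim simp
        qed (use int in \<open>auto intro!: set_integrable_sets BP\<close>)
        finally show "(LINT \<omega>:B|P. Y t \<omega> - Y' t \<omega>) \<le> (LINT \<omega>:B|P. \<delta>)" .
      qed simp_all
    qed
    have "AE \<omega> in P. \<forall>k. Y t \<omega> - Y' t \<omega> \<le> inverse (real (Suc k))"
      by (subst AE_all_countable) (auto intro!: le_\<delta>)
    then show "AE \<omega> in P. Y t \<omega> - Y' t \<omega> \<le> 0"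
    proof eventually_elim
      case (elim \<omega>)
      show ?case
        by (rule LIMSEQ_le_const[OF LIMSEQ_inverse_real_of_nat]) (use elim in auto)
    qed
  qed
  then show ?thesis by eventually_elim auto
qed

text \<open>
  This is where the right support enters: to the right of one of its points the clock is strictly
  above its value at that point, so convergence of the clock values forces convergence of the times.
\<close>

lemma support_passage_times_converge:
  fixes a :: real
  assumes a: "a \<in> support_bar T A \<omega>" "a \<le> T"
    and path: "mono_on {0..T} (\<lambda>t. A t \<omega>)"
    and r: "\<And>k. a \<le> r k" "\<And>k. r k \<le> T" and lim: "(\<lambda>k. A (r k) \<omega>) \<longlonglongrightarrow> A a \<omega>"
  shows "r \<longlonglongrightarrow> a"
proof (cases "a < T")
  case True
  then have a0: "0 \<le> a" and supp: "\<And>e. e > 0 \<Longrightarrow> A a \<omega> < A (min (a + e) T) \<omega>"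
    using a by (auto simp: support_bar_def right_support_def min_absorb1)
  show ?thesis
  proof (rule order_tendstoI)
    fix b assume "b < a"
    then show "eventually (\<lambda>k. b < r k) sequentially"
      using r(1) by (intro always_eventually allI) (meson less_le_trans)
  next
    fix b assume b: "a < b"
    have "A a \<omega> < A (min b T) \<omega>" using supp[of "b - a"] b by simp
    then have "eventually (\<lambda>k. A (r k) \<omega> < A (min b T) \<omega>) sequentially"
      using lim by (rule order_tendstoD(2)[rotated])
    then show "eventually (\<lambda>k. r k < b) sequentially"
    proof eventually_elim
      case (elim k)
      show ?case
      proof (rule ccontr)
        assume "\<not> r k < b"
        then have "A (min b T) \<omega> \<le> A (r k) \<omega>"
          using path a0 b True r(1,2)[of k] by (auto simp: mono_on_def)
        with elim show False by simp
      qed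
    qed
  qed
next
  case False
  then have "r k = a" for k using r[of k] a(2) by simp
  then have "r = (\<lambda>_. a)" by auto
  then show ?thesis by simp
qed

context
  fixes Y :: "nat \<Rightarrow> real \<Rightarrow> 'a \<Rightarrow> real"
  assumes sol: "\<And>n. penalized_solution P F T A \<xi> \<eta> K n (Y n)"
begin

lemma incseq_solutions: "AE \<omega> in P. \<forall>t\<in>{0..T}. incseq (\<lambda>n. Y n t \<omega>)"
proof -
  have "AE \<omega> in P. \<forall>n. \<forall>t\<in>{0..T}. Y n t \<omega> \<le> Y (Suc n) t \<omega>"
    by (subst AE_all_countable) (intro allI penalized_solution_mono[OF sol sol], simp)
  then show ?thesis by eventually_elim (auto intro: incseq_SucI)
qed

lemma solutions_bounded: "AE \<omega> in P. \<forall>n. \<forall>t\<in>{0..T}. \<bar>Y n t \<omega>\<bar> \<le> K"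
proof (subst AE_all_countable, intro allI)
  fix n
  show "AE \<omega> in P. \<forall>t\<in>{0..T}. \<bar>Y n t \<omega>\<bar> \<le> K"
    using penalized_solution.Y_upper[OF sol, of n] penalized_solution.Y_lower[OF sol, of n]
    by eventually_elim (force simp: abs_le_iff)
qed

lemma solutions_converge:
  "AE \<omega> in P. \<forall>t\<in>{0..T}. (\<lambda>n. Y n t \<omega>) \<longlonglongrightarrow> lim (\<lambda>n. Y n t \<omega>)"
  using incseq_solutions solutions_bounded
proof eventually_elim
  case (elim \<omega>)
  show ?case
  proof
    fix t assume t: "t \<in> {0..T}"
    have "Bseq (\<lambda>n. Y n t \<omega>)" using elim(2) t by (intro BseqI'[of _ K]) auto
    then have "convergent (\<lambda>n. Y n t \<omega>)"
      using elim(1) t by (intro Bseq_monoseq_convergent incseq_imp_monoseq) auto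
    then show "(\<lambda>n. Y n t \<omega>) \<longlonglongrightarrow> lim (\<lambda>n. Y n t \<omega>)"
      by (simp add: convergent_LIMSEQ_iff)
  qed
qed

section \<open>The limit dominates the payoff of every admissible stopping time\<close>

context
  fixes t :: real and \<tau> :: "'a \<Rightarrow> real" and \<delta> :: real
  assumes t: "t \<in> {0..T}" and \<tau>: "\<tau> \<in> support_stopping_times_from P F T A t" and \<delta>: "0 < \<delta>"
begin

text \<open>
  Equal to \<open>\<tau>\<close> almost surely; the maximum ensures \<open>t \<le> start\<close> everywhere, as optional stopping requires.
\<close>

definition start :: "'a \<Rightarrow> real" where
  "start \<omega> = max (\<tau> \<omega>) t"

text \<open>
  Before this time the solution stays below the obstacle by at least \<open>\<delta>\<close>; at this time, unless it
  equals \<open>T\<close>, the gap is at most \<open>\<delta>\<close>.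
\<close>

definition contact :: "nat \<Rightarrow> 'a \<Rightarrow> real" where
  "contact n \<omega> = passage_time T (start \<omega>) (\<lambda>s. Y n s \<omega> - \<eta> s \<omega>) (- \<delta>)"

lemmas \<tau>_stopping = support_stopping_times_from_imp_stopping_times[OF \<tau>]

lemma start_stopping: "start \<in> stopping_times P F T"
  using \<tau>_stopping const_stopping_times[OF t] stopping_time_max[of F \<tau> "\<lambda>_. t"]
  by (auto simp: stopping_times_def start_def[abs_def])

lemma start_AE: "AE \<omega> in P. start \<omega> = \<tau> \<omega> \<and> start \<omega> \<in> support_bar T A \<omega>"
proof -
  have "AE \<omega> in P. \<tau> \<omega> \<in> support_bar T A \<omega> \<inter> {t..T}"
    using \<tau> by (simp add: support_stopping_times_from_def)
  then show ?thesis by eventually_elim (auto simp: start_def max_def)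
qed

lemma contact_stopping: "contact n \<in> stopping_times P F T"
proof -
  have "adapted F T (\<lambda>s \<omega>. Y n s \<omega> - \<eta> s \<omega>)"
    using penalized_solution.Y_adapted[OF sol, of n] \<eta>_adapted
    by (auto simp: adapted_def intro!: borel_measurable_diff)
  then show ?thesis
    unfolding contact_def[abs_def] by (rule passage_time_stopping_times[OF start_stopping])
qed

lemma start_bounds:
  assumes "\<omega> \<in> space P"
  shows "0 \<le> start \<omega>" "t \<le> start \<omega>"
  using stopping_times_bounds[OF start_stopping assms] by (auto simp: start_def)

lemma contact_bounds:
  assumes "\<omega> \<in> space P"
  shows "start \<omega> \<le> contact n \<omega>" "contact n \<omega> \<le> T"
  using stopping_times_bounds[OF start_stopping assms]
  by (auto simp: contact_def passage_time_le passage_time_ge)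

text \<open>
  Up to the contact time the integrand of the penalty is at least \<open>n \<delta>\<close>.
\<close>

lemma clock_increment_to_contact:
  assumes "\<omega> \<in> space P" and "right_cont_path T (\<lambda>s. Y n s \<omega>)" "right_cont_path T (\<lambda>s. \<eta> s \<omega>)"
    and path: "mono_on {0..T} (\<lambda>t. A t \<omega>)" "continuous_on {0..T} (\<lambda>t. A t \<omega>)"
    and int: "set_integrable (path_measure T A \<omega>) {0<..T} (\<lambda>s. real n * max 0 (\<eta> s \<omega> - Y n s \<omega>))"
  shows "real n * \<delta> * (A (contact n \<omega>) \<omega> - A (start \<omega>) \<omega>) \<le>
    (LINT u:{start \<omega><..contact n \<omega>}|path_measure T A \<omega>. real n * max 0 (\<eta> u \<omega> - Y n u \<omega>))"
proof (rule path_integral_ge[OF T_pos path int])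
  note b = start_bounds[OF assms(1)] contact_bounds[OF assms(1), of n]
  show "0 \<le> start \<omega>" "start \<omega> \<le> contact n \<omega>" "contact n \<omega> \<le> T" using b by auto
  fix u assume u: "start \<omega> < u" "u < contact n \<omega>"
  have "right_cont_path T (\<lambda>s. Y n s \<omega> - \<eta> s \<omega>)"
    using assms(2,3) by (auto simp: right_cont_path_def intro: tendsto_diff)
  then have "Y n u \<omega> - \<eta> u \<omega> \<le> - \<delta>"
    using u b passage_time_before[of T "\<lambda>s. Y n s \<omega> - \<eta> s \<omega>" u "start \<omega>" "- \<delta>"]
    by (simp add: contact_def)
  then show "real n * \<delta> \<le> real n * max 0 (\<eta> u \<omega> - Y n u \<omega>)"
    by (intro mult_left_mono) simp_all
qed

text \<open>
  The expected clock increment between \<open>start\<close> and \<open>contact n\<close> is at most \<open>2 K / (n \<delta>)\<close>, since the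
  expected penalty is bounded by \<open>2 K\<close>. This gives convergence to \<open>0\<close> in \<open>L\<^sup>1\<close>. The solutions increase
  with \<open>n\<close>, so the contact times decrease and the convergence is almost sure.
\<close>

lemma contact_clock_converges:
  "AE \<omega> in P. (\<lambda>n. A (contact n \<omega>) \<omega>) \<longlonglongrightarrow> A (start \<omega>) \<omega>"
proof -
  define D where "D n \<omega> = A (contact n \<omega>) \<omega> - A (start \<omega>) \<omega>" for n \<omega>
  have A_adapted: "adapted F T A" using clock by (simp add: clock_process_def)
  have A_rc: "AE \<omega> in P. right_cont_path T (\<lambda>t. A t \<omega>)"
    using clock_path by eventually_elim (auto intro: continuous_on_imp_right_cont_path)
  have D_measurable: "D n \<in> borel_measurable P" for n
    unfolding D_def
    by (intro borel_measurable_diff stopped_value_measurable[OF _ A_adapted A_rc]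
        contact_stopping start_stopping)
  have A_T: "integrable P (A T)"
  proof (rule Bochner_Integration.integrable_bound)
    show "integrable P (\<lambda>\<omega>. 1 + (A T \<omega>)\<^sup>2)" using clock by (simp add: clock_process_def)
    show "A T \<in> borel_measurable P"
      using T_pos by (intro adapted_imp_measurable[OF A_adapted]) auto
    have "\<bar>x\<bar> \<le> 1 + x\<^sup>2" for x :: real
    proof -
      have "0 \<le> (\<bar>x\<bar> - 1)\<^sup>2" by simp
      then have "2 * \<bar>x\<bar> \<le> 1 + x\<^sup>2" by (simp add: power2_diff)
      then show ?thesis by linarith
    qed
    then show "AE \<omega> in P. norm (A T \<omega>) \<le> norm (1 + (A T \<omega>)\<^sup>2)" by (intro AE_I2) simp
  qed
  have D_bounds: "AE \<omega> in P. \<forall>n. 0 \<le> D n \<omega> \<and> D n \<omega> \<le> A T \<omega>"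
    using clock AE_space unfolding clock_process_def
  proof (elim conjE, elim eventually_elim2)
    fix \<omega> assume A: "A 0 \<omega> = 0 \<and> mono_on {0..T} (\<lambda>t. A t \<omega>) \<and> continuous_on {0..T} (\<lambda>t. A t \<omega>)"
      and \<omega>: "\<omega> \<in> space P"
    have m: "\<And>r s. 0 \<le> r \<Longrightarrow> r \<le> s \<Longrightarrow> s \<le> T \<Longrightarrow> A r \<omega> \<le> A s \<omega>"
      using A by (auto simp: mono_on_def)
    show "\<forall>n. 0 \<le> D n \<omega> \<and> D n \<omega> \<le> A T \<omega>"
    proof
      fix n
      note b = start_bounds[OF \<omega>] contact_bounds[OF \<omega>, of n]
      have "A 0 \<omega> \<le> A (start \<omega>) \<omega>" "A (start \<omega>) \<omega> \<le> A (contact n \<omega>) \<omega>"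
          "A (contact n \<omega>) \<omega> \<le> A T \<omega>"
        using b by (auto intro!: m)
      then show "0 \<le> D n \<omega> \<and> D n \<omega> \<le> A T \<omega>" using A by (simp add: D_def)
    qed
  qed
  have D_integrable: "integrable P (D n)" for n
  proof (rule Bochner_Integration.integrable_bound[OF A_T D_measurable])
    show "AE \<omega> in P. norm (D n \<omega>) \<le> norm (A T \<omega>)"
      using D_bounds by eventually_elim (metis abs_of_nonneg order_trans real_norm_def)
  qed
  have D_decseq: "AE \<omega> in P. decseq (\<lambda>n. D n \<omega>)"
    using incseq_solutions clock_path AE_space
  proof eventually_elim
    case (elim \<omega>)
    show ?case
    proof (rule decseq_SucI)
      fix n
      note b = start_bounds[OF elim(3)] contact_bounds[OF elim(3), of n] contact_bounds[OF elim(3), of "Suc n"]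
      have "Y n s \<omega> \<le> Y (Suc n) s \<omega>" if "start \<omega> \<le> s" "s \<le> T" for s
        using elim(1) that b by (auto simp: incseq_Suc_iff)
      then have "contact (Suc n) \<omega> \<le> contact n \<omega>"
        unfolding contact_def using b by (intro passage_time_antimono) auto
      then show "D (Suc n) \<omega> \<le> D n \<omega>"
        using elim(2) b by (auto simp: D_def mono_on_def)
    qed
  qed
  have D_expectation: "real n * \<delta> * (LINT \<omega>|P. D n \<omega>) \<le> 2 * K" for n
  proof -
    interpret S: penalized_solution P F T A \<xi> \<eta> K n "Y n" by (rule sol)
    have "AE \<omega> in P. real n * \<delta> * D n \<omega> \<le> S.I T \<omega>"
      using S.penalty_increment S.penalty_mono S.penalty_integrand S.Y_right_cont \<eta>_right_cont
        clock_path AE_space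
    proof eventually_elim
      case (elim \<omega>)
      note b = start_bounds[OF elim(7)] contact_bounds[OF elim(7), of n]
      have "real n * \<delta> * D n \<omega> \<le> S.I (contact n \<omega>) \<omega> - S.I (start \<omega>) \<omega>"
        using clock_increment_to_contact[OF elim(7,4,5) _ _ elim(3)] elim(1,6) b
        by (simp add: D_def)
      moreover have "S.I 0 \<omega> \<le> S.I (start \<omega>) \<omega>" "S.I (contact n \<omega>) \<omega> \<le> S.I T \<omega>"
        using elim(2) b by auto
      ultimately show ?case by (simp add: S.penalty_0)
    qed
    then have "(LINT \<omega>|P. real n * \<delta> * D n \<omega>) \<le> (LINT \<omega>|P. S.I T \<omega>)"
      using D_integrable S.penalty_integrable by (intro integral_mono_AE) auto
    then show ?thesis using S.expected_penalty by simp
  qed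
  have lim: "AE \<omega> in P. (\<lambda>n. D n \<omega>) \<longlonglongrightarrow> lim (\<lambda>n. D n \<omega>)"
    using D_decseq D_bounds
  proof eventually_elim
    case (elim \<omega>)
    have "Bseq (\<lambda>n. D n \<omega>)" using elim(2) by (intro BseqI'[of _ "A T \<omega>"]) auto
    then have "convergent (\<lambda>n. D n \<omega>)"
      using elim(1) by (intro Bseq_monoseq_convergent decseq_imp_monoseq)
    then show ?case by (simp add: convergent_LIMSEQ_iff)
  qed
  have lim_measurable: "(\<lambda>\<omega>. lim (\<lambda>n. D n \<omega>)) \<in> borel_measurable P"
    by (intro borel_measurable_lim_metric D_measurable)
  have dom: "AE \<omega> in P. norm (D n \<omega>) \<le> A T \<omega>" for n
    using D_bounds by eventually_elim auto
  note dct = integral_dominated_convergence[OF lim_measurable D_measurable A_T lim dom]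
    integrable_dominated_convergence[OF lim_measurable D_measurable A_T lim dom]
  have "(\<lambda>n. LINT \<omega>|P. D n \<omega>) \<longlonglongrightarrow> 0"
  proof (rule tendsto_sandwich[of "\<lambda>_. 0"])
    show "eventually (\<lambda>n. 0 \<le> (LINT \<omega>|P. D n \<omega>)) sequentially"
    proof (rule always_eventually, rule allI, rule integral_nonneg_AE)
      show "AE \<omega> in P. 0 \<le> D n \<omega>" for n using D_bounds by eventually_elim auto
    qed
    show "eventually (\<lambda>n. (LINT \<omega>|P. D n \<omega>) \<le> (2 * K / \<delta>) * inverse (real n)) sequentially"
      using eventually_gt_at_top[of 0]
    proof eventually_elim
      case (elim n)
      then show ?case using D_expectation[of n] \<delta> by (simp add: field_simps)
    qed
    have "(\<lambda>n. (2 * K / \<delta>) * inverse (real n)) \<longlonglongrightarrow> (2 * K / \<delta>) * 0"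
      by (intro tendsto_mult tendsto_const lim_inverse_n)
    then show "(\<lambda>n. (2 * K / \<delta>) * inverse (real n)) \<longlonglongrightarrow> 0" by simp
  qed simp
  then have "(LINT \<omega>|P. lim (\<lambda>n. D n \<omega>)) = 0"
    using dct(1) by (rule LIMSEQ_unique[rotated])
  moreover have "AE \<omega> in P. 0 \<le> lim (\<lambda>n. D n \<omega>)"
    using lim D_bounds by eventually_elim (auto intro: LIMSEQ_le_const)
  ultimately have "AE \<omega> in P. lim (\<lambda>n. D n \<omega>) = 0"
    using integral_nonneg_eq_0_iff_AE[OF dct(2)] by simp
  with lim show ?thesis
  proof eventually_elim
    case (elim \<omega>)
    then have "(\<lambda>n. D n \<omega> + A (start \<omega>) \<omega>) \<longlonglongrightarrow> 0 + A (start \<omega>) \<omega>"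
      by (intro tendsto_add tendsto_const) simp
    then show ?case by (simp add: D_def)
  qed
qed

text \<open>
  Where \<open>start < T\<close>, the contact times are eventually below \<open>T\<close> and approach \<open>start\<close> from the right, along
  which \<open>\<eta>\<close> is continuous; where \<open>start = T\<close>, they all equal \<open>T\<close>.
\<close>

lemma contact_payoff_converges:
  "AE \<omega> in P. (\<lambda>n. payoff (contact n) \<omega>) \<longlonglongrightarrow> payoff \<tau> \<omega>"
  using contact_clock_converges start_AE clock_path \<eta>_right_cont AE_space
proof eventually_elim
  case (elim \<omega>)
  note b = start_bounds[OF elim(5)] contact_bounds[OF elim(5)]
  have sT: "start \<omega> \<le> T" using b(3,4) by (rule order_trans)
  have path: "mono_on {0..T} (\<lambda>t. A t \<omega>)" using elim(3) by simp
  have lim: "(\<lambda>n. contact n \<omega>) \<longlonglongrightarrow> start \<omega>"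
    using elim(1,2) b by (intro support_passage_times_converge[OF _ sT path]) auto
  show ?case
  proof (cases "start \<omega> < T")
    case True
    have "(\<lambda>n. \<eta> (contact n \<omega>) \<omega>) \<longlonglongrightarrow> \<eta> (start \<omega>) \<omega>"
      using b by (intro right_cont_path_sequence[OF elim(4) _ _ _ lim]) auto
    moreover have "eventually (\<lambda>n. \<eta> (contact n \<omega>) \<omega> = payoff (contact n) \<omega>) sequentially"
      using order_tendstoD(2)[OF lim True] by eventually_elim (simp add: payoff_def)
    ultimately have "(\<lambda>n. payoff (contact n) \<omega>) \<longlonglongrightarrow> \<eta> (start \<omega>) \<omega>"
      by (rule Lim_transform_eventually)
    then show ?thesis using elim(2) True by (simp add: payoff_def)
  next
    case False
    have "contact n \<omega> = T" for n using False b(3,4)[of n] by simp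
    moreover have "\<tau> \<omega> = T" using False elim(2) sT by simp
    ultimately show ?thesis by (simp add: payoff_def)
  qed
qed

text \<open>
  Start from \<open>Y\<close> at \<open>t\<close>, move to the contact time by the supermartingale property, where \<open>Y\<close> is at least the
  payoff up to \<open>\<delta>\<close>, and let \<open>n\<close> tend to infinity; all variables are bounded by \<open>K + \<delta>\<close>.
\<close>

lemma set_integral_payoff_le:
  assumes B: "B \<in> sets (F t)"
  shows "(LINT \<omega>:B|P. payoff \<tau> \<omega> - \<delta>) \<le> (LINT \<omega>:B|P. lim (\<lambda>n. Y n t \<omega>))"
proof -
  have BP: "B \<in> sets P" using B t sets_F_imp_sets by blast
  note Y_integrable = penalized_solution.stopped_Y_integrable[OF sol]
  have le: "(LINT \<omega>:B|P. payoff (contact n) \<omega> - \<delta>) \<le> (LINT \<omega>:B|P. Y n t \<omega>)" for n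
  proof -
    interpret S: penalized_solution P F T A \<xi> \<eta> K n "Y n" by (rule sol)
    have "AE \<omega> in P. payoff (contact n) \<omega> - \<delta> \<le> Y n (contact n \<omega>) \<omega>"
      using S.Y_right_cont \<eta>_right_cont S.Y_terminal AE_space
    proof eventually_elim
      case (elim \<omega>)
      note b = start_bounds[OF elim(4)] contact_bounds[OF elim(4), of n]
      show ?case
      proof (cases "contact n \<omega> < T")
        case True
        have "right_cont_path T (\<lambda>s. Y n s \<omega> - \<eta> s \<omega>)"
          using elim(1,2) by (auto simp: right_cont_path_def intro: tendsto_diff)
        then have "- \<delta> \<le> Y n (contact n \<omega>) \<omega> - \<eta> (contact n \<omega>) \<omega>"
          using passage_time_at[of T "\<lambda>s. Y n s \<omega> - \<eta> s \<omega>" "start \<omega>" "- \<delta>"] True b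
          by (simp add: contact_def)
        then show ?thesis using True by (simp add: payoff_def)
      next
        case False
        then show ?thesis using b elim(3) \<delta> by (simp add: payoff_def)
      qed
    qed
    then have "(LINT \<omega>:B|P. payoff (contact n) \<omega> - \<delta>) \<le> (LINT \<omega>:B|P. Y n (contact n \<omega>) \<omega>)"
      by (intro set_integral_mono_AE set_integrable_sets BP Bochner_Integration.integrable_diff
          payoff_integrable contact_stopping Y_integrable) (auto elim: eventually_mono)
    also have "\<dots> \<le> (LINT \<omega>:B|P. Y n t \<omega>)"
    proof (rule S.stopped_Y_le[OF contact_stopping t _ B])
      fix \<omega> assume "\<omega> \<in> space P"
      then show "t \<le> contact n \<omega>"
        using start_bounds[of \<omega>] contact_bounds[of \<omega> n] by linarith
    qed
    finally show ?thesis .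
  qed
  have "(\<lambda>n. LINT \<omega>:B|P. payoff (contact n) \<omega> - \<delta>) \<longlonglongrightarrow> (LINT \<omega>:B|P. payoff \<tau> \<omega> - \<delta>)"
    unfolding set_lebesgue_integral_def
  proof (rule integral_dominated_convergence[where w = "\<lambda>_. K + \<delta>"])
    show "AE \<omega> in P. (\<lambda>n. indicat_real B \<omega> *\<^sub>R (payoff (contact n) \<omega> - \<delta>))
        \<longlonglongrightarrow> indicat_real B \<omega> *\<^sub>R (payoff \<tau> \<omega> - \<delta>)"
      using contact_payoff_converges by eventually_elim (intro tendsto_intros)
    show "AE \<omega> in P. norm (indicat_real B \<omega> *\<^sub>R (payoff (contact n) \<omega> - \<delta>)) \<le> K + \<delta>" for n
      using payoff_bound[OF contact_stopping, of n]
      by eventually_elim (use \<delta> in \<open>auto simp: indicator_def\<close>)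
  qed (use BP payoff_measurable[OF \<tau>_stopping] payoff_measurable[OF contact_stopping] in auto)
  moreover have "(\<lambda>n. LINT \<omega>:B|P. Y n t \<omega>) \<longlonglongrightarrow> (LINT \<omega>:B|P. lim (\<lambda>n. Y n t \<omega>))"
    unfolding set_lebesgue_integral_def
  proof (rule integral_dominated_convergence[where w = "\<lambda>_. K"])
    have meas: "Y n t \<in> borel_measurable P" for n
      using Y_integrable[OF const_stopping_times[OF t]] by simp
    show "(\<lambda>\<omega>. indicat_real B \<omega> *\<^sub>R Y n t \<omega>) \<in> borel_measurable P" for n
      using BP meas by simp
    show "(\<lambda>\<omega>. indicat_real B \<omega> *\<^sub>R lim (\<lambda>n. Y n t \<omega>)) \<in> borel_measurable P"
      using BP borel_measurable_lim_metric[OF meas] by simp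
    show "AE \<omega> in P. (\<lambda>n. indicat_real B \<omega> *\<^sub>R Y n t \<omega>) \<longlonglongrightarrow> indicat_real B \<omega> *\<^sub>R lim (\<lambda>n. Y n t \<omega>)"
      using solutions_converge
    proof eventually_elim
      case (elim \<omega>)
      then show ?case using t by (intro tendsto_scaleR tendsto_const) auto
    qed
    show "AE \<omega> in P. norm (indicat_real B \<omega> *\<^sub>R Y n t \<omega>) \<le> K" for n
      using solutions_bounded
    proof eventually_elim
      case (elim \<omega>)
      then have "\<bar>Y n t \<omega>\<bar> \<le> K" using t by auto
      then show ?case by (auto simp: indicator_def)
    qed
  qed simp
  ultimately show ?thesis by (rule LIMSEQ_le) (use le in auto)
qed

end


lemma real_cond_exp_payoff_le:
  assumes t: "t \<in> {0..T}" and \<tau>: "\<tau> \<in> support_stopping_times_from P F T A t"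
  shows "AE \<omega> in P. real_cond_exp P (F t) (payoff \<tau>) \<omega> \<le> lim (\<lambda>n. Y n t \<omega>)"
proof -
  have meas: "(\<lambda>\<omega>. lim (\<lambda>n. Y n t \<omega>)) \<in> borel_measurable (F t)"
    using penalized_solution.Y_adapted[OF sol] t
    by (intro borel_measurable_lim_metric) (auto simp: adapted_def)
  have bound: "AE \<omega> in P. \<bar>lim (\<lambda>n. Y n t \<omega>)\<bar> \<le> K"
    using solutions_converge solutions_bounded
  proof eventually_elim
    case (elim \<omega>)
    have "(\<lambda>n. \<bar>Y n t \<omega>\<bar>) \<longlonglongrightarrow> \<bar>lim (\<lambda>n. Y n t \<omega>)\<bar>"
      using elim(1) t by (intro tendsto_rabs) auto
    then show ?case using elim(2) t by (intro LIMSEQ_le_const2) auto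
  qed
  have int: "integrable P (\<lambda>\<omega>. lim (\<lambda>n. Y n t \<omega>))"
    using bound measurable_F_imp_measurable[OF t meas] by (intro integrable_const_bound[of _ K]) auto
  have \<tau>': "\<tau> \<in> stopping_times P F T" by (rule support_stopping_times_from_imp_stopping_times[OF \<tau>])
  show ?thesis
  proof (rule real_cond_exp_leI[OF t int meas payoff_integrable[OF \<tau>']])
    fix B assume B: "B \<in> sets (F t)"
    then have BP: "B \<in> sets P" using t sets_F_imp_sets by blast
    have "(LINT \<omega>:B|P. payoff \<tau> \<omega>) \<le> (LINT \<omega>:B|P. lim (\<lambda>n. Y n t \<omega>)) + \<epsilon>" if "0 < \<epsilon>" for \<epsilon>
    proof -
      have "(LINT \<omega>:B|P. payoff \<tau> \<omega> - \<epsilon>) = (LINT \<omega>:B|P. payoff \<tau> \<omega>) - measure P B * \<epsilon>"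
        using payoff_integrable[OF \<tau>'] BP
        by (subst set_integral_diff(2)) (auto intro: set_integrable_sets simp: set_integral_const)
      moreover have "measure P B * \<epsilon> \<le> 1 * \<epsilon>" using that by (intro mult_right_mono) auto
      ultimately show ?thesis using set_integral_payoff_le[OF t \<tau> that B] by simp
    qed
    then show "(LINT \<omega>:B|P. payoff \<tau> \<omega>) \<le> (LINT \<omega>:B|P. lim (\<lambda>n. Y n t \<omega>))"
      by (rule field_le_epsilon)
  qed
qed

text \<open>
  Each \<open>Y n t\<close> lies below one member of the family and the limit lies above every member, so a bound of
  the family bounds all \<open>Y n t\<close> and therefore their limit.
\<close>

lemma limit_is_ess_sup:
  assumes t: "t \<in> {0..T}"
  shows "is_ess_sup P {real_cond_exp P (F t) (payoff \<tau>) |\<tau>. \<tau> \<in> support_stopping_times_from P F T A t}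
    (\<lambda>\<omega>. lim (\<lambda>n. Y n t \<omega>))"
  unfolding is_ess_sup_def
proof (intro conjI ballI impI)
  show "(\<lambda>\<omega>. lim (\<lambda>n. Y n t \<omega>)) \<in> borel_measurable P"
    using penalized_solution.stopped_Y_integrable[OF sol const_stopping_times[OF t]]
    by (intro borel_measurable_lim_metric) auto
  show "AE \<omega> in P. \<phi> \<omega> \<le> lim (\<lambda>n. Y n t \<omega>)"
    if "\<phi> \<in> {real_cond_exp P (F t) (payoff \<tau>) |\<tau>. \<tau> \<in> support_stopping_times_from P F T A t}" for \<phi>
    using that real_cond_exp_payoff_le[OF t] by auto
  fix X' :: "'a \<Rightarrow> real"
  assume X': "\<forall>\<phi>\<in>{real_cond_exp P (F t) (payoff \<tau>) |\<tau>. \<tau> \<in> support_stopping_times_from P F T A t}.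
    AE \<omega> in P. \<phi> \<omega> \<le> X' \<omega>"
  have "AE \<omega> in P. \<forall>n. Y n t \<omega> \<le> X' \<omega>"
  proof (subst AE_all_countable, intro allI)
    fix n
    obtain \<sigma> where \<sigma>: "\<sigma> \<in> support_stopping_times_from P F T A t"
        "AE \<omega> in P. Y n t \<omega> \<le> real_cond_exp P (F t) (payoff \<sigma>) \<omega>"
      using penalized_solution.le_cond_exp_payoff[OF sol t] by blast
    then have "AE \<omega> in P. real_cond_exp P (F t) (payoff \<sigma>) \<omega> \<le> X' \<omega>" using X' by blast
    with \<sigma>(2) show "AE \<omega> in P. Y n t \<omega> \<le> X' \<omega>" by eventually_elim simp
  qed
  with solutions_converge show "AE \<omega> in P. lim (\<lambda>n. Y n t \<omega>) \<le> X' \<omega>"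
  proof eventually_elim
    case (elim \<omega>)
    then show ?case using t by (intro LIMSEQ_le_const2[of "\<lambda>n. Y n t \<omega>"]) auto
  qed
qed

end

end

section \<open>Penalization converges to the optimal stopping value\<close>

theorem theorem3p1:
  fixes P :: "'a measure" and F :: "real \<Rightarrow> 'a measure" and T :: real
    and M :: "real \<Rightarrow> 'a \<Rightarrow> real ^ 'd" and A :: "real \<Rightarrow> 'a \<Rightarrow> real"
    and \<xi> :: "'a \<Rightarrow> real" and \<eta> :: "real \<Rightarrow> 'a \<Rightarrow> real"
    and Y :: "nat \<Rightarrow> real \<Rightarrow> 'a \<Rightarrow> real" and Z :: "nat \<Rightarrow> real \<Rightarrow> 'a \<Rightarrow> real ^ 'd"
  assumes "T > 0"
    and "prob_space P"
    and "usual_filtration P F T"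
    and "square_integrable_martingale P F T M"
    and "predictable_representation P F T M"
    and "clock_process P F T A"
    and "\<xi> \<in> borel_measurable (F T)" and "\<exists>C. AE \<omega> in P. \<bar>\<xi> \<omega>\<bar> \<le> C"
    and "optional P F T \<eta>"
    and "\<exists>C. AE \<omega> in P. \<forall>t\<in>{0..T}. \<bar>\<eta> t \<omega>\<bar> \<le> C"
    and "AE \<omega> in P. \<forall>t\<in>{0..T}. 0 \<le> \<eta> t \<omega>"
    and "AE \<omega> in P. right_cont_path T (\<lambda>t. \<eta> t \<omega>)"
    and "\<And>n. generator_assumption P T A (\<lambda>t \<omega> y. real n * max 0 (\<eta> t \<omega> - y))"
    and "\<And>n. Y n \<in> S2_space P F T" and "\<And>n. Z n \<in> H2_space P F T M"
    and "\<And>n. gbsde_solution P F T M A \<xi> (\<lambda>t \<omega> y. real n * max 0 (\<eta> t \<omega> - y)) (Y n) (Z n)"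
  shows "\<exists>V. adapted F T V \<and>
    (AE \<omega> in P. \<forall>t\<in>{0..T}. incseq (\<lambda>n. Y n t \<omega>) \<and> (\<lambda>n. Y n t \<omega>) \<longlonglongrightarrow> V t \<omega>) \<and>
    (\<forall>t\<in>{0..T}. is_ess_sup P
       {real_cond_exp P (F t)
          (\<lambda>\<omega>. \<xi> \<omega> * indicator {\<omega>. \<tau> \<omega> = T} \<omega> + \<eta> (\<tau> \<omega>) \<omega> * indicator {\<omega>. \<tau> \<omega> < T} \<omega>)
        |\<tau>. \<tau> \<in> support_stopping_times_from P F T A t}
       (V t))"
proof -
  interpret U: usual_prob_space P F T
    using \<open>prob_space P\<close> \<open>0 < T\<close> \<open>usual_filtration P F T\<close>
    by (intro usual_prob_space.intro usual_prob_space_axioms.intro)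
  obtain C1 where C1: "AE \<omega> in P. \<bar>\<xi> \<omega>\<bar> \<le> C1" using assms(8) by blast
  obtain C2 where C2: "AE \<omega> in P. \<forall>t\<in>{0..T}. \<bar>\<eta> t \<omega>\<bar> \<le> C2" using assms(10) by blast
  define K where "K = max C1 C2"
  interpret S: penalization P F T A \<xi> \<eta> K
  proof unfold_locales
    show "AE \<omega> in P. \<bar>\<xi> \<omega>\<bar> \<le> K" using C1 by eventually_elim (simp add: K_def)
    show "AE \<omega> in P. \<forall>t\<in>{0..T}. \<bar>\<eta> t \<omega>\<bar> \<le> K"
      using C2 by eventually_elim (force simp: K_def)
    show "adapted F T \<eta>" by (rule U.optional_imp_adapted) fact
  qed fact+
  have sol: "penalized_solution P F T A \<xi> \<eta> K n (Y n)" for n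
    by (rule S.gbsde_solution_imp_penalized_solution[OF assms(14,16)])
  have payoff: "(\<lambda>\<omega>. \<xi> \<omega> * indicator {\<omega>. \<tau> \<omega> = T} \<omega> + \<eta> (\<tau> \<omega>) \<omega> * indicator {\<omega>. \<tau> \<omega> < T} \<omega>) =
      S.payoff \<tau>" for \<tau>
    by (rule ext) (simp add: S.payoff_def)
  \<comment> \<open>Being measurable also where the sequence diverges, \<open>lim\<close> gives a process adapted on all of \<open>\<Omega>\<close>.\<close>
  show ?thesis
  proof (intro exI[of _ "\<lambda>t \<omega>. lim (\<lambda>n. Y n t \<omega>)"] conjI ballI)
    show "adapted F T (\<lambda>t \<omega>. lim (\<lambda>n. Y n t \<omega>))"
      using penalized_solution.Y_adapted[OF sol]
      by (auto simp: adapted_def intro!: borel_measurable_lim_metric)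
    show "AE \<omega> in P. \<forall>t\<in>{0..T}. incseq (\<lambda>n. Y n t \<omega>) \<and>
        (\<lambda>n. Y n t \<omega>) \<longlonglongrightarrow> lim (\<lambda>n. Y n t \<omega>)"
      using S.incseq_solutions[OF sol] S.solutions_converge[OF sol] by eventually_elim blast
    show "is_ess_sup P
       {real_cond_exp P (F t)
          (\<lambda>\<omega>. \<xi> \<omega> * indicator {\<omega>. \<tau> \<omega> = T} \<omega> + \<eta> (\<tau> \<omega>) \<omega> * indicator {\<omega>. \<tau> \<omega> < T} \<omega>)
        |\<tau>. \<tau> \<in> support_stopping_times_from P F T A t}
       (\<lambda>\<omega>. lim (\<lambda>n. Y n t \<omega>))" if "t \<in> {0..T}" for t
      unfolding payoff by (rule S.limit_is_ess_sup[OF sol that])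
  qed
qed

end
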